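(* Let $\Lambda$ be a weakly finite ring with $1$ and involution and $\epsilon=(-1)^q$. Let $x=(F\xleftarrow{\sigma}H\xrightarrow{\tau}F^*,\bar\psi)$ be an $\epsilon$-quadratic split preformation and let $G$ be a f.g. free $\Lambda$-module with an epimorphism $\pi:G\to H$. Then there is an $\epsilon$-quadratic split preformation $y=(F\xleftarrow{\gamma}G\xrightarrow{\mu}F^*,\bar\theta)$ with $\gamma=\sigma\pi$, $\mu=\tau\pi$ and $\bar\theta=\bar\psi\pi$; $y$ is regular, and $x$ is elementary if and only if $y$ is elementary.
   Context: A ring $\Lambda$ is weakly finite if for all $n\ge 0$ and all modules $K$, $\Lambda^n\cong\Lambda^n\oplus K$ implies $K=0$. An involution is an anti-automorphism $x\mapsto\bar x$ of order two. Modules are left modules; $M^*=\mathrm{Hom}_\Lambda(M,\Lambda)$ with $(af)(x)=f(x)\bar a$. For $\phi\in\mathrm{Hom}_\Lambda(M,M^* )$, $\phi^*(x)(y)=\overline{\phi(y)(x)}$ and $\phi(x,y)=\phi(x)(y)$. For $e=\pm1$, $Q_e(\Lambda)=\Lambda/\{b-e\bar b\}$. An $e$-quadratic form $(M,\lambda,\nu)$ consists of $\lambda=e\lambda^*\in\mathrm{Hom}_\Lambda(M,M^* )$ and $\nu:M\to Q_e(\Lambda)$ such that $\nu(x+y)-\nu(x)-\nu(y)=\lambda(x,y)$ in $Q_e(\Lambda)$, $\nu(x)+e\overline{\nu(x)}=\lambda(x,x)$ and $\nu(ax)=a\nu(x)\bar a$. An $\epsilon$-quadratic split preformation $(F\xleftarrow{\gamma}G\xrightarrow{\mu}F^*,\bar\theta)$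 consists of a f.g. (finitely generated) free module $F$, a f.g. module $G$, homomorphisms $\gamma:G\to F$, $\mu:G\to F^*$ and a map $\bar\theta:G\to Q_{-\epsilon}(\Lambda)$ such that $(G,\gamma^*\mu,\bar\theta)$ is a $(-\epsilon)$-quadratic form. It is regular if $G$ is free. It is elementary if there is a f.g. free submodule $j:U\hookrightarrow G$ with $j^*\gamma^*\mu j=0$, $\bar\theta j=0$, such that $\gamma j$ and $\mu j$ are injective with images $U_0\subset F$, $U_1\subset F^*$ direct summands, and $F^*/U_1\to U_0^*$, $f\mapsto f|_{U_0}$, is an isomorphism. *)

theory Defs
  imports "HOL-Algebra.Module" "HOL-Algebra.AbelCoset"
begin

section \<open>Left modules over a not necessarily commutative ring\<close>

text \<open>
  The locale \<^locale>\<open>module\<close> of the library requires a commutative ring. The record type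
  of modules and the locale \<^locale>\<open>submodule\<close>, which do not, are reused. The
  multiplicative fields of the record play no role and are left unspecified.
\<close>

locale left_module = R?: ring R + M?: abelian_group M
  for R :: "('r, 'a) ring_scheme" (structure) and M :: "('r, 'm) module" (structure) +
  assumes smult_closed [simp, intro]:
      "\<lbrakk>a \<in> carrier R; x \<in> carrier M\<rbrakk> \<Longrightarrow> a \<odot>\<^bsub>M\<^esub> x \<in> carrier M"
    and smult_l_distr:
      "\<lbrakk>a \<in> carrier R; b \<in> carrier R; x \<in> carrier M\<rbrakk> \<Longrightarrow>
        (a \<oplus>\<^bsub>R\<^esub> b) \<odot>\<^bsub>M\<^esub> x = a \<odot>\<^bsub>M\<^esub> x \<oplus>\<^bsub>M\<^esub> b \<odot>\<^bsub>M\<^esub> x"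
    and smult_r_distr:
      "\<lbrakk>a \<in> carrier R; x \<in> carrier M; y \<in> carrier M\<rbrakk> \<Longrightarrow>
        a \<odot>\<^bsub>M\<^esub> (x \<oplus>\<^bsub>M\<^esub> y) = a \<odot>\<^bsub>M\<^esub> x \<oplus>\<^bsub>M\<^esub> a \<odot>\<^bsub>M\<^esub> y"
    and smult_assoc1:
      "\<lbrakk>a \<in> carrier R; b \<in> carrier R; x \<in> carrier M\<rbrakk> \<Longrightarrow>
        (a \<otimes>\<^bsub>R\<^esub> b) \<odot>\<^bsub>M\<^esub> x = a \<odot>\<^bsub>M\<^esub> (b \<odot>\<^bsub>M\<^esub> x)"
    and smult_one [simp]: "x \<in> carrier M \<Longrightarrow> \<one>\<^bsub>R\<^esub> \<odot>\<^bsub>M\<^esub> x = x"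

definition mod_hom ::
    "('r, 'a) ring_scheme \<Rightarrow> ('r, 'm) module \<Rightarrow> ('r, 'n) module \<Rightarrow> ('m \<Rightarrow> 'n) set" where
  "mod_hom R M N = {h \<in> carrier M \<rightarrow> carrier N.
     (\<forall>x\<in>carrier M. \<forall>y\<in>carrier M. h (x \<oplus>\<^bsub>M\<^esub> y) = h x \<oplus>\<^bsub>N\<^esub> h y) \<and>
     (\<forall>a\<in>carrier R. \<forall>x\<in>carrier M. h (a \<odot>\<^bsub>M\<^esub> x) = a \<odot>\<^bsub>N\<^esub> h x)}"

definition mod_iso ::
    "('r, 'a) ring_scheme \<Rightarrow> ('r, 'm) module \<Rightarrow> ('r, 'n) module \<Rightarrow> ('m \<Rightarrow> 'n) set" where
  "mod_iso R M N = {h \<in> mod_hom R M N. bij_betw h (carrier M) (carrier N)}"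

definition generates :: "('r, 'a) ring_scheme \<Rightarrow> ('r, 'm) module \<Rightarrow> 'm set \<Rightarrow> bool" where
  "generates R M B \<longleftrightarrow> B \<subseteq> carrier M \<and>
     (\<forall>x\<in>carrier M. \<exists>A c. finite A \<and> A \<subseteq> B \<and> c \<in> A \<rightarrow> carrier R \<and>
        x = (\<Oplus>\<^bsub>M\<^esub>b\<in>A. c b \<odot>\<^bsub>M\<^esub> b))"

definition independent :: "('r, 'a) ring_scheme \<Rightarrow> ('r, 'm) module \<Rightarrow> 'm set \<Rightarrow> bool" where
  "independent R M B \<longleftrightarrow> B \<subseteq> carrier M \<and>
     (\<forall>A c. finite A \<and> A \<subseteq> B \<and> c \<in> A \<rightarrow> carrier R \<and>
        (\<Oplus>\<^bsub>M\<^esub>b\<in>A. c b \<odot>\<^bsub>M\<^esub> b) = \<zero>\<^bsub>M\<^esub> \<longrightarrow> (\<forall>b\<in>A. c b = \<zero>\<^bsub>R\<^esub>))"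

definition fin_gen :: "('r, 'a) ring_scheme \<Rightarrow> ('r, 'm) module \<Rightarrow> bool" where
  "fin_gen R M \<longleftrightarrow> (\<exists>B. finite B \<and> generates R M B)"

definition free_module :: "('r, 'a) ring_scheme \<Rightarrow> ('r, 'm) module \<Rightarrow> bool" where
  "free_module R M \<longleftrightarrow> (\<exists>B. generates R M B \<and> independent R M B)"

definition direct_summand :: "('r, 'a) ring_scheme \<Rightarrow> ('r, 'm) module \<Rightarrow> 'm set \<Rightarrow> bool" where
  "direct_summand R M U \<longleftrightarrow> submodule U R M \<and>
     (\<exists>V. submodule V R M \<and> U <+>\<^bsub>M\<^esub> V = carrier M \<and> U \<inter> V = {\<zero>\<^bsub>M\<^esub>})"

definition quot_mod :: "('r, 'm) module \<Rightarrow> 'm set \<Rightarrow> ('r, 'm set) module" where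
  "quot_mod M U = \<lparr>carrier = a_rcosets\<^bsub>M\<^esub> U, mult = undefined, one = undefined,
     zero = U, add = (<+>\<^bsub>M\<^esub>), smult = (\<lambda>a C. \<Union>x\<in>C. U +>\<^bsub>M\<^esub> (a \<odot>\<^bsub>M\<^esub> x))\<rparr>"


section \<open>Weakly finite rings\<close>

definition power_mod :: "('r, 'a) ring_scheme \<Rightarrow> nat \<Rightarrow> ('r, nat \<Rightarrow> 'r) module" where
  "power_mod R n = \<lparr>carrier = {..<n} \<rightarrow>\<^sub>E carrier R, mult = undefined, one = undefined,
     zero = (\<lambda>i\<in>{..<n}. \<zero>\<^bsub>R\<^esub>), add = (\<lambda>v w. \<lambda>i\<in>{..<n}. v i \<oplus>\<^bsub>R\<^esub> w i),
     smult = (\<lambda>a v. \<lambda>i\<in>{..<n}. a \<otimes>\<^bsub>R\<^esub> v i)\<rparr>"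

definition direct_sum_mod :: "('r, 'm) module \<Rightarrow> ('r, 'n) module \<Rightarrow> ('r, 'm \<times> 'n) module" where
  "direct_sum_mod M N = \<lparr>carrier = carrier M \<times> carrier N, mult = undefined, one = undefined,
     zero = (\<zero>\<^bsub>M\<^esub>, \<zero>\<^bsub>N\<^esub>), add = (\<lambda>(x, y) (x', y'). (x \<oplus>\<^bsub>M\<^esub> x', y \<oplus>\<^bsub>N\<^esub> y')),
     smult = (\<lambda>a (x, y). (a \<odot>\<^bsub>M\<^esub> x, a \<odot>\<^bsub>N\<^esub> y))\<rparr>"

text \<open>
  A definition cannot quantify over the type of the elements of the module \<open>K\<close>. This is no
  loss: if \<open>K\<close> satisfies the hypothesis it embeds into the n-th power of the ring, so up to
  isomorphism its elements are functions \<^typ>\<open>nat \<Rightarrow> 'r\<close>. See \<open>weakly_finite_any_type\<close> below.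
\<close>

definition weakly_finite :: "('r, 'a) ring_scheme \<Rightarrow> bool" where
  "weakly_finite R \<longleftrightarrow>
     (\<forall>n. \<forall>K :: ('r, nat \<Rightarrow> 'r) module. left_module R K \<longrightarrow>
        mod_iso R (power_mod R n) (direct_sum_mod (power_mod R n) K) \<noteq> {} \<longrightarrow>
        carrier K = {\<zero>\<^bsub>K\<^esub>})"


section \<open>Rings with involution, duals\<close>

text \<open>The trivial involution of a commutative ring is allowed.\<close>

locale ring_with_involution = ring R for R :: "('r, 'a) ring_scheme" (structure) +
  fixes bar :: "'r \<Rightarrow> 'r"
  assumes bar_closed [simp, intro]: "a \<in> carrier R \<Longrightarrow> bar a \<in> carrier R"
    and bar_add: "\<lbrakk>a \<in> carrier R; b \<in> carrier R\<rbrakk> \<Longrightarrow> bar (a \<oplus> b) = bar a \<oplus> bar b"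
    and bar_mult: "\<lbrakk>a \<in> carrier R; b \<in> carrier R\<rbrakk> \<Longrightarrow> bar (a \<otimes> b) = bar b \<otimes> bar a"
    and bar_one [simp]: "bar \<one> = \<one>"
    and bar_bar [simp]: "a \<in> carrier R \<Longrightarrow> bar (bar a) = a"

definition ring_as_mod :: "('r, 'a) ring_scheme \<Rightarrow> ('r, 'r) module" where
  "ring_as_mod R = \<lparr>carrier = carrier R, mult = undefined, one = undefined,
     zero = \<zero>\<^bsub>R\<^esub>, add = (\<oplus>\<^bsub>R\<^esub>), smult = (\<otimes>\<^bsub>R\<^esub>)\<rparr>"

text \<open>
  Functionals are taken to be extensional, so that equality in the dual is equality on the
  carrier of the module.
\<close>

definition dual :: "('r, 'a) ring_scheme \<Rightarrow> ('r \<Rightarrow> 'r) \<Rightarrow> ('r, 'm) module \<Rightarrow> ('r, 'm \<Rightarrow> 'r) module"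
  where
  "dual R bar M = \<lparr>carrier = mod_hom R M (ring_as_mod R) \<inter> extensional (carrier M),
     mult = undefined, one = undefined,
     zero = (\<lambda>x\<in>carrier M. \<zero>\<^bsub>R\<^esub>),
     add = (\<lambda>f g. \<lambda>x\<in>carrier M. f x \<oplus>\<^bsub>R\<^esub> g x),
     smult = (\<lambda>a f. \<lambda>x\<in>carrier M. f x \<otimes>\<^bsub>R\<^esub> bar a)\<rparr>"

text \<open>The map induced on duals by a homomorphism \<open>h\<close> with domain \<open>M\<close>.\<close>

definition dual_map :: "('r, 'm) module \<Rightarrow> ('m \<Rightarrow> 'n) \<Rightarrow> ('n \<Rightarrow> 'r) \<Rightarrow> 'm \<Rightarrow> 'r" where
  "dual_map M h f = compose (carrier M) f h"

text \<open>The adjoint \<open>\<phi>\<^sup>*\<close> of a homomorphism \<open>\<phi>\<close> from \<open>M\<close> to its dual.\<close>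

definition adjoint :: "('r \<Rightarrow> 'r) \<Rightarrow> ('r, 'm) module \<Rightarrow> ('m \<Rightarrow> 'm \<Rightarrow> 'r) \<Rightarrow> 'm \<Rightarrow> 'm \<Rightarrow> 'r" where
  "adjoint bar M \<phi> = (\<lambda>x\<in>carrier M. \<lambda>y\<in>carrier M. bar (\<phi> y x))"


section \<open>Quadratic forms\<close>

text \<open>Throughout, the sign \<open>e\<close> is an element of the ring, equal to plus or minus one.\<close>

definition Q_sub :: "('r, 'a) ring_scheme \<Rightarrow> ('r \<Rightarrow> 'r) \<Rightarrow> 'r \<Rightarrow> 'r set" where
  "Q_sub R bar e = {b \<ominus>\<^bsub>R\<^esub> e \<otimes>\<^bsub>R\<^esub> bar b | b. b \<in> carrier R}"

definition Q_group :: "('r, 'a) ring_scheme \<Rightarrow> ('r \<Rightarrow> 'r) \<Rightarrow> 'r \<Rightarrow> 'r set monoid" where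
  "Q_group R bar e = R A_Mod Q_sub R bar e"

definition Q_class :: "('r, 'a) ring_scheme \<Rightarrow> ('r \<Rightarrow> 'r) \<Rightarrow> 'r \<Rightarrow> 'r \<Rightarrow> 'r set" where
  "Q_class R bar e b = Q_sub R bar e +>\<^bsub>R\<^esub> b"

text \<open>
  The maps induced on classes by \<open>b \<mapsto> b + e * bar b\<close> (with values in the ring) and by
  \<open>b \<mapsto> a * b * bar a\<close>; see \<open>Q_symm_class\<close> and \<open>Q_conj_class\<close> below.
\<close>

definition Q_symm :: "('r, 'a) ring_scheme \<Rightarrow> ('r \<Rightarrow> 'r) \<Rightarrow> 'r \<Rightarrow> 'r set \<Rightarrow> 'r" where
  "Q_symm R bar e C = the_elem ((\<lambda>b. b \<oplus>\<^bsub>R\<^esub> e \<otimes>\<^bsub>R\<^esub> bar b) ` C)"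

definition Q_conj :: "('r, 'a) ring_scheme \<Rightarrow> ('r \<Rightarrow> 'r) \<Rightarrow> 'r \<Rightarrow> 'r \<Rightarrow> 'r set \<Rightarrow> 'r set" where
  "Q_conj R bar e a C = the_elem ((\<lambda>b. Q_class R bar e (a \<otimes>\<^bsub>R\<^esub> b \<otimes>\<^bsub>R\<^esub> bar a)) ` C)"

text \<open>The operation of the monoid record \<^const>\<open>Q_group\<close> is the addition of classes.\<close>

definition quadratic_form ::
    "('r, 'a) ring_scheme \<Rightarrow> ('r \<Rightarrow> 'r) \<Rightarrow> 'r \<Rightarrow> ('r, 'm) module \<Rightarrow>
     ('m \<Rightarrow> 'm \<Rightarrow> 'r) \<Rightarrow> ('m \<Rightarrow> 'r set) \<Rightarrow> bool" where
  "quadratic_form R bar e M \<phi> \<nu> \<longleftrightarrow>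
     e \<in> {\<one>\<^bsub>R\<^esub>, \<ominus>\<^bsub>R\<^esub> \<one>\<^bsub>R\<^esub>} \<and> left_module R M \<and>
     \<phi> \<in> mod_hom R M (dual R bar M) \<and>
     (\<forall>x\<in>carrier M. \<phi> x = e \<odot>\<^bsub>dual R bar M\<^esub> adjoint bar M \<phi> x) \<and>
     \<nu> \<in> carrier M \<rightarrow> carrier (Q_group R bar e) \<and>
     (\<forall>x\<in>carrier M. \<forall>y\<in>carrier M.
        \<nu> (x \<oplus>\<^bsub>M\<^esub> y) \<otimes>\<^bsub>Q_group R bar e\<^esub> inv\<^bsub>Q_group R bar e\<^esub> \<nu> x
          \<otimes>\<^bsub>Q_group R bar e\<^esub> inv\<^bsub>Q_group R bar e\<^esub> \<nu> y = Q_class R bar e (\<phi> x y)) \<and>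
     (\<forall>x\<in>carrier M. Q_symm R bar e (\<nu> x) = \<phi> x x) \<and>
     (\<forall>a\<in>carrier R. \<forall>x\<in>carrier M. \<nu> (a \<odot>\<^bsub>M\<^esub> x) = Q_conj R bar e a (\<nu> x))"


section \<open>Split preformations\<close>

definition split_preformation ::
    "('r, 'a) ring_scheme \<Rightarrow> ('r \<Rightarrow> 'r) \<Rightarrow> 'r \<Rightarrow> ('r, 'f) module \<Rightarrow> ('r, 'g) module \<Rightarrow>
     ('g \<Rightarrow> 'f) \<Rightarrow> ('g \<Rightarrow> 'f \<Rightarrow> 'r) \<Rightarrow> ('g \<Rightarrow> 'r set) \<Rightarrow> bool" where
  "split_preformation R bar \<epsilon> F G \<gamma> \<mu> \<theta> \<longleftrightarrow>
     left_module R F \<and> fin_gen R F \<and> free_module R F \<and>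
     left_module R G \<and> fin_gen R G \<and>
     \<gamma> \<in> mod_hom R G F \<and> \<mu> \<in> mod_hom R G (dual R bar F) \<and>
     quadratic_form R bar (\<ominus>\<^bsub>R\<^esub> \<epsilon>) G (dual_map G \<gamma> \<circ> \<mu>) \<theta>"

definition regular_preformation ::
    "('r, 'a) ring_scheme \<Rightarrow> ('r \<Rightarrow> 'r) \<Rightarrow> 'r \<Rightarrow> ('r, 'f) module \<Rightarrow> ('r, 'g) module \<Rightarrow>
     ('g \<Rightarrow> 'f) \<Rightarrow> ('g \<Rightarrow> 'f \<Rightarrow> 'r) \<Rightarrow> ('g \<Rightarrow> 'r set) \<Rightarrow> bool" where
  "regular_preformation R bar \<epsilon> F G \<gamma> \<mu> \<theta> \<longleftrightarrow>
     split_preformation R bar \<epsilon> F G \<gamma> \<mu> \<theta> \<and> free_module R G"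

text \<open>
  The inclusion \<open>j\<close> of \<open>U\<close> is the identity function. The last conjunct refers to the
  restriction map on cosets; it is well defined on them because of the condition on
  \<open>j\<^sup>* \<gamma>\<^sup>* \<mu> j\<close>, see \<open>restrict_class\<close> below.
\<close>

definition elementary_preformation ::
    "('r, 'a) ring_scheme \<Rightarrow> ('r \<Rightarrow> 'r) \<Rightarrow> 'r \<Rightarrow> ('r, 'f) module \<Rightarrow> ('r, 'g) module \<Rightarrow>
     ('g \<Rightarrow> 'f) \<Rightarrow> ('g \<Rightarrow> 'f \<Rightarrow> 'r) \<Rightarrow> ('g \<Rightarrow> 'r set) \<Rightarrow> bool" where
  "elementary_preformation R bar \<epsilon> F G \<gamma> \<mu> \<theta> \<longleftrightarrow>
     split_preformation R bar \<epsilon> F G \<gamma> \<mu> \<theta> \<and>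
     (\<exists>U. submodule U R G \<and>
        fin_gen R (G\<lparr>carrier := U\<rparr>) \<and> free_module R (G\<lparr>carrier := U\<rparr>) \<and>
        (\<forall>u\<in>U. dual_map (G\<lparr>carrier := U\<rparr>) (\<lambda>u. u) (dual_map G \<gamma> (\<mu> u))
                 = \<zero>\<^bsub>dual R bar (G\<lparr>carrier := U\<rparr>)\<^esub>) \<and>
        (\<forall>u\<in>U. \<theta> u = \<one>\<^bsub>Q_group R bar (\<ominus>\<^bsub>R\<^esub> \<epsilon>)\<^esub>) \<and>
        inj_on \<gamma> U \<and> inj_on \<mu> U \<and>
        direct_summand R F (\<gamma> ` U) \<and> direct_summand R (dual R bar F) (\<mu> ` U) \<and>
        (\<lambda>C. the_elem ((\<lambda>f. restrict f (\<gamma> ` U)) ` C))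
          \<in> mod_iso R (quot_mod (dual R bar F) (\<mu> ` U))
                      (dual R bar (F\<lparr>carrier := \<gamma> ` U\<rparr>)))"


section \<open>The definitions above are well behaved\<close>

context ring_with_involution
begin

lemma bar_zero [simp]: "bar \<zero> = \<zero>"
  using bar_add[of \<zero> \<zero>] by (metis add.l_cancel_one' bar_closed l_zero zero_closed)

lemma bar_minus: "a \<in> carrier R \<Longrightarrow> bar (\<ominus> a) = \<ominus> bar a"
  by (metis a_inv_closed add.inv_equality bar_add bar_closed bar_zero l_neg)

lemma dual_left_module:
  assumes "left_module R M"
  shows "left_module R (dual R bar M)"
proof -
  interpret M: left_module R M by fact
  let ?D = "dual R bar M"
  have D: "f \<in> carrier ?D \<longleftrightarrow> f \<in> extensional (carrier M) \<and>
      (\<forall>x\<in>carrier M. f x \<in> carrier R) \<and>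
      (\<forall>x\<in>carrier M. \<forall>y\<in>carrier M. f (x \<oplus>\<^bsub>M\<^esub> y) = f x \<oplus> f y) \<and>
      (\<forall>a\<in>carrier R. \<forall>x\<in>carrier M. f (a \<odot>\<^bsub>M\<^esub> x) = a \<otimes> f x)" for f
    by (auto simp: dual_def mod_hom_def ring_as_mod_def)
  have ab: "abelian_group ?D"
  proof (rule abelian_groupI)
    fix f g h assume f: "f \<in> carrier ?D" and g: "g \<in> carrier ?D" and h: "h \<in> carrier ?D"
    show "f \<oplus>\<^bsub>?D\<^esub> g \<in> carrier ?D"
      using f g unfolding D by (auto simp: dual_def r_distr a_ac)
    show "f \<oplus>\<^bsub>?D\<^esub> g \<oplus>\<^bsub>?D\<^esub> h = f \<oplus>\<^bsub>?D\<^esub> (g \<oplus>\<^bsub>?D\<^esub> h)"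
      using f g h unfolding D by (auto simp: dual_def a_ac intro!: restrict_ext)
  next
    fix f g assume f: "f \<in> carrier ?D" and g: "g \<in> carrier ?D"
    show "f \<oplus>\<^bsub>?D\<^esub> g = g \<oplus>\<^bsub>?D\<^esub> f"
      using f g unfolding D by (auto simp: dual_def a_ac intro!: restrict_ext)
  next
    show "\<zero>\<^bsub>?D\<^esub> \<in> carrier ?D" unfolding D by (auto simp: dual_def)
  next
    fix f assume f: "f \<in> carrier ?D"
    show "\<zero>\<^bsub>?D\<^esub> \<oplus>\<^bsub>?D\<^esub> f = f"
      using f unfolding D by (auto simp: dual_def intro!: extensionalityI[of _ "carrier M"])
    have "(\<lambda>x\<in>carrier M. \<ominus> f x) \<in> carrier ?D"
      using f unfolding D by (auto simp: r_minus minus_add)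
    moreover have "(\<lambda>x\<in>carrier M. \<ominus> f x) \<oplus>\<^bsub>?D\<^esub> f = \<zero>\<^bsub>?D\<^esub>"
      using f unfolding D by (auto simp: dual_def l_neg intro!: restrict_ext)
    ultimately show "\<exists>g\<in>carrier ?D. g \<oplus>\<^bsub>?D\<^esub> f = \<zero>\<^bsub>?D\<^esub>" by blast
  qed
  show ?thesis
  proof (intro left_module.intro left_module_axioms.intro ab ring_axioms)
    fix a b f g assume a: "a \<in> carrier R" and f: "f \<in> carrier ?D"
    show "a \<odot>\<^bsub>?D\<^esub> f \<in> carrier ?D"
      using a f unfolding D by (auto simp: dual_def l_distr m_assoc)
    assume b: "b \<in> carrier R"
    show "(a \<oplus> b) \<odot>\<^bsub>?D\<^esub> f = a \<odot>\<^bsub>?D\<^esub> f \<oplus>\<^bsub>?D\<^esub> b \<odot>\<^bsub>?D\<^esub> f"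
      using a b f unfolding D by (auto simp: dual_def bar_add r_distr intro!: restrict_ext)
    show "(a \<otimes> b) \<odot>\<^bsub>?D\<^esub> f = a \<odot>\<^bsub>?D\<^esub> (b \<odot>\<^bsub>?D\<^esub> f)"
      using a b f unfolding D by (auto simp: dual_def bar_mult m_assoc intro!: restrict_ext)
  next
    fix f assume "f \<in> carrier ?D"
    then show "\<one> \<odot>\<^bsub>?D\<^esub> f = f"
      unfolding D by (auto simp: dual_def intro!: extensionalityI[of _ "carrier M"])
  next
    fix a f g assume "a \<in> carrier R" "f \<in> carrier ?D" "g \<in> carrier ?D"
    then show "a \<odot>\<^bsub>?D\<^esub> (f \<oplus>\<^bsub>?D\<^esub> g) = a \<odot>\<^bsub>?D\<^esub> f \<oplus>\<^bsub>?D\<^esub> a \<odot>\<^bsub>?D\<^esub> g"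
      unfolding D by (auto simp: dual_def l_distr intro!: restrict_ext)
  qed
qed

context
  fixes e assumes e: "e \<in> {\<one>, \<ominus> \<one>}"
begin

lemma sign_closed [simp, intro]: "e \<in> carrier R"
  using e by auto

lemma sign_sq: "x \<in> carrier R \<Longrightarrow> e \<otimes> (e \<otimes> x) = x"
  using e by (auto simp: l_minus)

lemma bar_sign [simp]: "bar e = e"
  using e by (auto simp: bar_minus)

lemma sign_comm: "x \<in> carrier R \<Longrightarrow> x \<otimes> e = e \<otimes> x"
  using e by (auto simp: l_minus r_minus)

lemma sign_lcomm:
  assumes "x \<in> carrier R" "y \<in> carrier R"
  shows "x \<otimes> (e \<otimes> y) = e \<otimes> (x \<otimes> y)"
  using assms e by (auto simp: l_minus r_minus)

lemma Q_sub_subgroup: "additive_subgroup (Q_sub R bar e) R"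
proof (intro additive_subgroup.intro add.subgroupI)
  show "Q_sub R bar e \<subseteq> carrier R" by (auto simp: Q_sub_def)
  show "Q_sub R bar e \<noteq> {}" by (auto simp: Q_sub_def)
  fix x assume "x \<in> Q_sub R bar e"
  then obtain b where b: "b \<in> carrier R" "x = b \<ominus> e \<otimes> bar b" by (auto simp: Q_sub_def)
  have "\<ominus> x = \<ominus> b \<ominus> e \<otimes> bar (\<ominus> b)"
    using b by (simp add: bar_minus r_minus minus_eq minus_add a_ac)
  then show "\<ominus> x \<in> Q_sub R bar e"
    using b by (auto simp: Q_sub_def)
  fix y assume "y \<in> Q_sub R bar e"
  then obtain c where c: "c \<in> carrier R" "y = c \<ominus> e \<otimes> bar c" by (auto simp: Q_sub_def)
  have "x \<oplus> y = (b \<oplus> c) \<ominus> e \<otimes> bar (b \<oplus> c)"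
    using b c by (simp add: bar_add r_distr minus_eq minus_add a_ac)
  then show "x \<oplus> y \<in> Q_sub R bar e"
    using b c by (auto simp: Q_sub_def)
qed

lemma Q_class_iff: "x \<in> Q_class R bar e b \<longleftrightarrow> (\<exists>s\<in>Q_sub R bar e. x = s \<oplus> b)"
  by (auto simp: Q_class_def a_r_coset_def r_coset_def)

lemma Q_class_self: "b \<in> carrier R \<Longrightarrow> b \<in> Q_class R bar e b"
  using additive_subgroup.zero_closed[OF Q_sub_subgroup] by (force simp: Q_class_iff)

lemma Q_class_eqI:
  assumes "s \<in> Q_sub R bar e" "b \<in> carrier R"
  shows "Q_class R bar e (s \<oplus> b) = Q_class R bar e b"
proof -
  interpret S: additive_subgroup "Q_sub R bar e" R by (rule Q_sub_subgroup)
  have s: "s \<in> carrier R" using assms by auto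
  have "Q_sub R bar e +> (s \<oplus> b) = (Q_sub R bar e +> s) +> b"
    using assms s S.a_subset by (simp add: a_coset_add_assoc)
  also have "Q_sub R bar e +> s = Q_sub R bar e"
    using assms s by (metis add.coset_join2 a_r_coset_def S.a_subgroup)
  finally show ?thesis by (simp add: Q_class_def)
qed

lemma Q_symm_class:
  assumes b: "b \<in> carrier R"
  shows "Q_symm R bar e (Q_class R bar e b) = b \<oplus> e \<otimes> bar b"
proof -
  have "x \<oplus> e \<otimes> bar x = b \<oplus> e \<otimes> bar b" if x: "x \<in> Q_class R bar e b" for x
  proof -
    obtain c where c: "c \<in> carrier R" "x = (c \<ominus> e \<otimes> bar c) \<oplus> b"
      using x by (auto simp: Q_class_iff Q_sub_def)
    have d: "(c \<ominus> d) \<oplus> (d \<ominus> c) = \<zero>" if "d \<in> carrier R" for d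
    proof -
      have "(c \<ominus> d) \<oplus> (d \<ominus> c) = (c \<oplus> \<ominus> c) \<oplus> (d \<oplus> \<ominus> d)"
        using c(1) that by (simp add: minus_eq a_ac del: r_neg l_neg)
      then show ?thesis using c(1) that by (simp add: r_neg)
    qed
    have 1: "(c \<ominus> e \<otimes> bar c) \<oplus> (e \<otimes> bar c \<ominus> c) = \<zero>"
      by (rule d) (use c in simp)
    have "x \<oplus> e \<otimes> bar x
        = ((c \<ominus> e \<otimes> bar c) \<oplus> (e \<otimes> bar c \<ominus> c)) \<oplus> (b \<oplus> e \<otimes> bar b)"
      using b c by (simp add: bar_add bar_minus bar_mult minus_eq r_distr r_minus sign_comm
          sign_sq a_ac)
    then show ?thesis using b by (simp add: 1)
  qed
  then have "(\<lambda>x. x \<oplus> e \<otimes> bar x) ` Q_class R bar e b = {b \<oplus> e \<otimes> bar b}"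
    using Q_class_self[OF b] by blast
  then show ?thesis by (simp add: Q_symm_def)
qed

lemma Q_conj_class:
  assumes a: "a \<in> carrier R" and b: "b \<in> carrier R"
  shows "Q_conj R bar e a (Q_class R bar e b) = Q_class R bar e (a \<otimes> b \<otimes> bar a)"
proof -
  have "Q_class R bar e (a \<otimes> x \<otimes> bar a) = Q_class R bar e (a \<otimes> b \<otimes> bar a)"
    if x: "x \<in> Q_class R bar e b" for x
  proof -
    obtain c where c: "c \<in> carrier R" "x = (c \<ominus> e \<otimes> bar c) \<oplus> b"
      using x by (auto simp: Q_class_iff Q_sub_def)
    let ?d = "a \<otimes> c \<otimes> bar a"
    have "a \<otimes> x \<otimes> bar a = (?d \<ominus> e \<otimes> bar ?d) \<oplus> a \<otimes> b \<otimes> bar a"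
      using a b c by (simp add: minus_eq l_distr r_distr l_minus r_minus bar_mult m_assoc
          sign_lcomm)
    moreover have "?d \<ominus> e \<otimes> bar ?d \<in> Q_sub R bar e"
      using a c by (auto simp: Q_sub_def)
    ultimately show ?thesis using a b by (simp add: Q_class_eqI)
  qed
  then have "(\<lambda>x. Q_class R bar e (a \<otimes> x \<otimes> bar a)) ` Q_class R bar e b
      = {Q_class R bar e (a \<otimes> b \<otimes> bar a)}"
    using Q_class_self[OF b] by blast
  then show ?thesis by (simp add: Q_conj_def)
qed

end

lemma restrict_class:
  assumes F: "left_module R F" and U: "U \<subseteq> carrier F"
    and W: "submodule W R (dual R bar F)"
    and van: "\<And>w u. w \<in> W \<Longrightarrow> u \<in> U \<Longrightarrow> w u = \<zero>"
    and f: "f \<in> carrier (dual R bar F)"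
  shows "the_elem ((\<lambda>f. restrict f U) ` (W +>\<^bsub>dual R bar F\<^esub> f)) = restrict f U"
proof -
  interpret D: left_module R "dual R bar F" by (rule dual_left_module[OF F])
  interpret W: submodule W R "dual R bar F" by (rule W)
  have z: "\<zero>\<^bsub>dual R bar F\<^esub> \<in> W" using W.one_closed by simp
  have fR: "\<And>u. u \<in> carrier F \<Longrightarrow> f u \<in> carrier R"
    using f by (auto simp: dual_def mod_hom_def ring_as_mod_def)
  have "restrict g U = restrict f U" if g: "g \<in> W +>\<^bsub>dual R bar F\<^esub> f" for g
  proof -
    obtain w where w: "w \<in> W" "g = w \<oplus>\<^bsub>dual R bar F\<^esub> f"
      using g by (auto simp: a_r_coset_def r_coset_def)
    have "g u = f u" if "u \<in> U" for u
      using that w(2) van[OF w(1) that] U fR by (auto simp: dual_def)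
    then show ?thesis by (auto intro!: restrict_ext)
  qed
  moreover have "f \<in> W +>\<^bsub>dual R bar F\<^esub> f"
    using z f by (force simp: a_r_coset_def r_coset_def)
  ultimately have "(\<lambda>f. restrict f U) ` (W +>\<^bsub>dual R bar F\<^esub> f) = {restrict f U}"
    by blast
  then show ?thesis by simp
qed

end

lemma (in left_module) quot_mod_left_module:
  assumes U: "submodule U R M"
  shows "left_module R (quot_mod M U)" and
    "\<lbrakk>a \<in> carrier R; x \<in> carrier M\<rbrakk> \<Longrightarrow>
      a \<odot>\<^bsub>quot_mod M U\<^esub> (U +>\<^bsub>M\<^esub> x) = U +>\<^bsub>M\<^esub> (a \<odot>\<^bsub>M\<^esub> x)"
proof -
  interpret U: submodule U R M by (rule U)
  let ?Q = "quot_mod M U"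
  have sg: "additive_subgroup U M"
    by (rule additive_subgroup.intro) (rule U.subgroup_axioms)
  have asg: "abelian_subgroup U M"
    by (rule abelian_subgroupI3[OF sg M.abelian_group_axioms])
  interpret A: abelian_subgroup U M by (rule asg)
  have C: "C \<in> carrier ?Q \<longleftrightarrow> (\<exists>x\<in>carrier M. C = U +>\<^bsub>M\<^esub> x)" for C
    by (auto simp: quot_mod_def A_RCOSETS_def RCOSETS_def a_r_coset_def)
  have add: "(U +>\<^bsub>M\<^esub> x) \<oplus>\<^bsub>?Q\<^esub> (U +>\<^bsub>M\<^esub> y) = U +>\<^bsub>M\<^esub> (x \<oplus>\<^bsub>M\<^esub> y)"
    if "x \<in> carrier M" "y \<in> carrier M" for x y
    using that by (simp add: quot_mod_def A.a_rcos_sum)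
  have self: "x \<in> U +>\<^bsub>M\<^esub> x" if "x \<in> carrier M" for x
    using that A.a_rcos_self by blast
  have sm: "a \<odot>\<^bsub>?Q\<^esub> (U +>\<^bsub>M\<^esub> x) = U +>\<^bsub>M\<^esub> (a \<odot>\<^bsub>M\<^esub> x)"
    if a: "a \<in> carrier R" and x: "x \<in> carrier M" for a x
  proof -
    have "U +>\<^bsub>M\<^esub> (a \<odot>\<^bsub>M\<^esub> y) = U +>\<^bsub>M\<^esub> (a \<odot>\<^bsub>M\<^esub> x)" if "y \<in> U +>\<^bsub>M\<^esub> x" for y
    proof -
      obtain u where u: "u \<in> U" "y = u \<oplus>\<^bsub>M\<^esub> x"
        using \<open>y \<in> U +>\<^bsub>M\<^esub> x\<close> by (auto simp: a_r_coset_def r_coset_def)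
      have "a \<odot>\<^bsub>M\<^esub> y = a \<odot>\<^bsub>M\<^esub> u \<oplus>\<^bsub>M\<^esub> a \<odot>\<^bsub>M\<^esub> x"
        using u a x U.subset by (auto simp: smult_r_distr)
      then have "a \<odot>\<^bsub>M\<^esub> y \<in> U +>\<^bsub>M\<^esub> (a \<odot>\<^bsub>M\<^esub> x)"
        using u a by (auto simp: a_r_coset_def r_coset_def)
      then show ?thesis
        by (rule M.a_repr_independence[OF _ smult_closed[OF a x] U.subgroup_axioms, symmetric])
    qed
    then have "(\<Union>y\<in>U +>\<^bsub>M\<^esub> x. U +>\<^bsub>M\<^esub> (a \<odot>\<^bsub>M\<^esub> y)) = U +>\<^bsub>M\<^esub> (a \<odot>\<^bsub>M\<^esub> x)"
      using self[OF x] by blast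
    then show ?thesis by (simp add: quot_mod_def)
  qed
  have zero: "\<zero>\<^bsub>?Q\<^esub> = U +>\<^bsub>M\<^esub> \<zero>\<^bsub>M\<^esub>"
    by (simp add: quot_mod_def A.a_subset)
  have ab: "abelian_group ?Q"
  proof (rule abelian_groupI)
    show "\<zero>\<^bsub>?Q\<^esub> \<in> carrier ?Q" unfolding C zero by auto
    fix X assume "X \<in> carrier ?Q"
    then obtain x where x: "x \<in> carrier M" "X = U +>\<^bsub>M\<^esub> x" unfolding C by blast
    show "\<zero>\<^bsub>?Q\<^esub> \<oplus>\<^bsub>?Q\<^esub> X = X" unfolding zero using x by (simp add: add)
    have "(U +>\<^bsub>M\<^esub> (\<ominus>\<^bsub>M\<^esub> x)) \<oplus>\<^bsub>?Q\<^esub> X = \<zero>\<^bsub>?Q\<^esub>"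
      unfolding zero using x by (simp add: add M.l_neg)
    moreover have "U +>\<^bsub>M\<^esub> (\<ominus>\<^bsub>M\<^esub> x) \<in> carrier ?Q" unfolding C using x by blast
    ultimately show "\<exists>Y\<in>carrier ?Q. Y \<oplus>\<^bsub>?Q\<^esub> X = \<zero>\<^bsub>?Q\<^esub>" by blast
    fix Y assume "Y \<in> carrier ?Q"
    then obtain y where y: "y \<in> carrier M" "Y = U +>\<^bsub>M\<^esub> y" unfolding C by blast
    show "X \<oplus>\<^bsub>?Q\<^esub> Y \<in> carrier ?Q" unfolding C using x y add by auto
    show "X \<oplus>\<^bsub>?Q\<^esub> Y = Y \<oplus>\<^bsub>?Q\<^esub> X" using x y by (simp add: add M.a_comm)
    fix Z assume "Z \<in> carrier ?Q"
    then obtain z where z: "z \<in> carrier M" "Z = U +>\<^bsub>M\<^esub> z" unfolding C by blast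
    show "X \<oplus>\<^bsub>?Q\<^esub> Y \<oplus>\<^bsub>?Q\<^esub> Z = X \<oplus>\<^bsub>?Q\<^esub> (Y \<oplus>\<^bsub>?Q\<^esub> Z)"
      using x y z by (simp add: add M.a_assoc)
  qed
  show "left_module R ?Q"
  proof (intro left_module.intro left_module_axioms.intro ab R.ring_axioms)
    fix a X assume a: "a \<in> carrier R" and "X \<in> carrier ?Q"
    then obtain x where x: "x \<in> carrier M" "X = U +>\<^bsub>M\<^esub> x" unfolding C by blast
    show "a \<odot>\<^bsub>?Q\<^esub> X \<in> carrier ?Q" unfolding C using x a sm by blast
    fix b assume b: "b \<in> carrier R"
    show "(a \<oplus> b) \<odot>\<^bsub>?Q\<^esub> X = a \<odot>\<^bsub>?Q\<^esub> X \<oplus>\<^bsub>?Q\<^esub> b \<odot>\<^bsub>?Q\<^esub> X"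
      using x a b by (simp add: sm add smult_l_distr)
    show "(a \<otimes> b) \<odot>\<^bsub>?Q\<^esub> X = a \<odot>\<^bsub>?Q\<^esub> (b \<odot>\<^bsub>?Q\<^esub> X)"
      using x a b by (simp add: sm smult_assoc1)
  next
    fix X assume "X \<in> carrier ?Q"
    then obtain x where x: "x \<in> carrier M" "X = U +>\<^bsub>M\<^esub> x" unfolding C by blast
    show "\<one> \<odot>\<^bsub>?Q\<^esub> X = X" using x by (simp add: sm)
  next
    fix a X Y assume a: "a \<in> carrier R" and "X \<in> carrier ?Q" "Y \<in> carrier ?Q"
    then obtain x y where "x \<in> carrier M" "X = U +>\<^bsub>M\<^esub> x" "y \<in> carrier M" "Y = U +>\<^bsub>M\<^esub> y"
      unfolding C by blast
    then show "a \<odot>\<^bsub>?Q\<^esub> (X \<oplus>\<^bsub>?Q\<^esub> Y) = a \<odot>\<^bsub>?Q\<^esub> X \<oplus>\<^bsub>?Q\<^esub> a \<odot>\<^bsub>?Q\<^esub> Y"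
      using a by (simp add: sm add smult_r_distr)
  qed
  show "\<lbrakk>a \<in> carrier R; x \<in> carrier M\<rbrakk> \<Longrightarrow>
      a \<odot>\<^bsub>?Q\<^esub> (U +>\<^bsub>M\<^esub> x) = U +>\<^bsub>M\<^esub> (a \<odot>\<^bsub>M\<^esub> x)"
    by (rule sm)
qed

text \<open>Transport of a module structure along an injection of its carrier.\<close>

lemma transport_left_module:
  fixes K :: "('r, 'k) module" and g :: "'k \<Rightarrow> 'n"
  assumes K: "left_module R K" and inj: "inj_on g (carrier K)"
  defines "h \<equiv> inv_into (carrier K) g"
  defines "K' \<equiv> \<lparr>carrier = g ` carrier K, mult = undefined, one = undefined,
     zero = g \<zero>\<^bsub>K\<^esub>, add = (\<lambda>x y. g (h x \<oplus>\<^bsub>K\<^esub> h y)), smult = (\<lambda>a x. g (a \<odot>\<^bsub>K\<^esub> h x))\<rparr>"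
  shows "left_module R K'" and "g \<in> mod_iso R K K'"
proof -
  interpret K: left_module R K by fact
  have hg [simp]: "h (g x) = x" if "x \<in> carrier K" for x
    using that inj by (simp add: h_def)
  have [simp]: "carrier K' = g ` carrier K" "\<zero>\<^bsub>K'\<^esub> = g \<zero>\<^bsub>K\<^esub>"
    "x \<oplus>\<^bsub>K'\<^esub> y = g (h x \<oplus>\<^bsub>K\<^esub> h y)" "a \<odot>\<^bsub>K'\<^esub> x = g (a \<odot>\<^bsub>K\<^esub> h x)" for x y a
    by (simp_all add: K'_def)
  have "abelian_group K'"
  proof (rule abelian_groupI)
    fix x assume "x \<in> carrier K'"
    then obtain k where k: "k \<in> carrier K" "x = g k" by auto
    have "g (\<ominus>\<^bsub>K\<^esub> k) \<oplus>\<^bsub>K'\<^esub> x = \<zero>\<^bsub>K'\<^esub>" using k by (simp add: K.M.l_neg)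
    then show "\<exists>y\<in>carrier K'. y \<oplus>\<^bsub>K'\<^esub> x = \<zero>\<^bsub>K'\<^esub>" using k by force
  qed (auto simp: K.M.a_ac)
  then show "left_module R K'"
    by (intro left_module.intro left_module_axioms.intro K.R.ring_axioms)
      (auto simp: K.smult_l_distr K.smult_r_distr K.smult_assoc1)
  show "g \<in> mod_iso R K K'"
    using inj by (auto simp: mod_iso_def mod_hom_def bij_betw_def)
qed

lemma weakly_finite_any_type:
  fixes K :: "('r, 'k) module"
  assumes wf: "weakly_finite R" and K: "left_module R K"
    and iso: "mod_iso R (power_mod R n) (direct_sum_mod (power_mod R n) K) \<noteq> {}"
  shows "carrier K = {\<zero>\<^bsub>K\<^esub>}"
proof -
  interpret K: left_module R K by fact
  let ?P = "power_mod R n"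
  obtain p where p: "p \<in> mod_iso R ?P (direct_sum_mod ?P K)" using iso by blast
  have bij: "bij_betw p (carrier ?P) (carrier ?P \<times> carrier K)"
    using p by (simp add: mod_iso_def direct_sum_mod_def)
  define i where "i = inv_into (carrier ?P) p"
  define g where "g k = i (\<zero>\<^bsub>?P\<^esub>, k)" for k
  have z: "\<zero>\<^bsub>?P\<^esub> \<in> carrier ?P" by (auto simp: power_mod_def)
  have inj: "inj_on g (carrier K)"
  proof (rule inj_onI)
    fix k l assume kl: "k \<in> carrier K" "l \<in> carrier K" "g k = g l"
    have "p (g k) = (\<zero>\<^bsub>?P\<^esub>, k)" "p (g l) = (\<zero>\<^bsub>?P\<^esub>, l)"
      unfolding g_def i_def using kl(1,2) z by (auto intro: bij_betw_inv_into_right[OF bij])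
    then have "(\<zero>\<^bsub>?P\<^esub>, k) = (\<zero>\<^bsub>?P\<^esub>, l)" unfolding kl(3) by (rule trans[OF sym])
    then show "k = l" by simp
  qed
  define h where "h = inv_into (carrier K) g"
  define K' :: "('r, nat \<Rightarrow> 'r) module" where "K' = \<lparr>carrier = g ` carrier K, mult = undefined, one = undefined,
     zero = g \<zero>\<^bsub>K\<^esub>, add = (\<lambda>x y. g (h x \<oplus>\<^bsub>K\<^esub> h y)), smult = (\<lambda>a x. g (a \<odot>\<^bsub>K\<^esub> h x))\<rparr>"
  have K': "left_module R K'" and g: "g \<in> mod_iso R K K'"
    using transport_left_module[OF K inj] unfolding K'_def h_def by blast+
  let ?q = "\<lambda>v. (fst (p v), g (snd (p v)))"
  have pm: "p v \<in> carrier ?P \<times> carrier K" if "v \<in> carrier ?P" for v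
    using bij that by (auto simp: bij_betw_def)
  have gb: "bij_betw g (carrier K) (carrier K')" using g by (simp add: mod_iso_def)
  have "bij_betw (map_prod id g) (carrier ?P \<times> carrier K) (carrier ?P \<times> carrier K')"
    using gb map_prod_inj_on[of id "carrier ?P" g "carrier K"]
      map_prod_surj_on[of id "carrier ?P" "carrier ?P" g "carrier K" "carrier K'"]
    unfolding bij_betw_def by (simp only: inj_on_id image_id id_apply simp_thms)
  then have "bij_betw (map_prod id g \<circ> p) (carrier ?P) (carrier ?P \<times> carrier K')"
    by (rule bij_betw_trans[OF bij])
  moreover have "map_prod id g \<circ> p = ?q" by (auto simp: fun_eq_iff map_prod_def split: prod.splits)
  ultimately have qb: "bij_betw ?q (carrier ?P) (carrier ?P \<times> carrier K')" by simp
  have "?q \<in> mod_iso R ?P (direct_sum_mod ?P K')"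
  proof -
    have 1: "p (v \<oplus>\<^bsub>?P\<^esub> w) = (fst (p v) \<oplus>\<^bsub>?P\<^esub> fst (p w), snd (p v) \<oplus>\<^bsub>K\<^esub> snd (p w))"
      if "v \<in> carrier ?P" "w \<in> carrier ?P" for v w
      using p that by (auto simp: mod_iso_def mod_hom_def direct_sum_mod_def split_beta)
    have 2: "p (a \<odot>\<^bsub>?P\<^esub> v) = (a \<odot>\<^bsub>?P\<^esub> fst (p v), a \<odot>\<^bsub>K\<^esub> snd (p v))"
      if "a \<in> carrier R" "v \<in> carrier ?P" for v a
      using p that by (auto simp: mod_iso_def mod_hom_def direct_sum_mod_def split_beta)
    have 3: "snd (p v) \<in> carrier K" if "v \<in> carrier ?P" for v using pm[OF that] by auto
    have 4: "g (k \<oplus>\<^bsub>K\<^esub> l) = g k \<oplus>\<^bsub>K'\<^esub> g l" if "k \<in> carrier K" "l \<in> carrier K" for k l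
      using g that by (simp add: mod_iso_def mod_hom_def)
    have 5: "g (a \<odot>\<^bsub>K\<^esub> k) = a \<odot>\<^bsub>K'\<^esub> g k" if "a \<in> carrier R" "k \<in> carrier K" for a k
      using g that by (simp add: mod_iso_def mod_hom_def)
    have 6: "?q \<in> carrier ?P \<rightarrow> carrier ?P \<times> carrier K'"
      using qb unfolding bij_betw_def by blast
    show ?thesis
      using qb 6 by (simp add: mod_iso_def mod_hom_def direct_sum_mod_def 1 2 3 4 5)
  qed
  then have "carrier K' = {\<zero>\<^bsub>K'\<^esub>}" using wf K' unfolding weakly_finite_def by blast
  then have "g ` carrier K = {g \<zero>\<^bsub>K\<^esub>}" by (simp add: K'_def)
  then show ?thesis using inj K.M.zero_closed by (auto simp: inj_on_def)
qed

end

theory Submission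
  imports Defs
begin

text \<open>
  The form on \<open>G\<close> is the pullback of the form on \<open>H\<close>. A Lagrangian \<open>U'\<close> of \<open>y\<close> is mapped
  injectively by \<open>\<pi>\<close>, because \<open>\<gamma> = \<sigma> \<circ> \<pi>\<close> is injective on it, and \<open>\<pi> U'\<close> is a Lagrangian of
  \<open>x\<close> with the same images in \<open>F\<close> and in its dual. Conversely a Lagrangian \<open>U\<close> of \<open>x\<close> is free,
  so lifting a basis along \<open>\<pi>\<close> yields a submodule of \<open>G\<close> which \<open>\<pi>\<close> maps isomorphically
  onto \<open>U\<close>.
\<close>

section \<open>Homomorphisms of left modules\<close>

lemma mod_homD:
  assumes "h \<in> mod_hom R M N"
  shows "x \<in> carrier M \<Longrightarrow> h x \<in> carrier N"
    and "\<lbrakk>x \<in> carrier M; y \<in> carrier M\<rbrakk> \<Longrightarrow> h (x \<oplus>\<^bsub>M\<^esub> y) = h x \<oplus>\<^bsub>N\<^esub> h y"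
    and "\<lbrakk>a \<in> carrier R; x \<in> carrier M\<rbrakk> \<Longrightarrow> h (a \<odot>\<^bsub>M\<^esub> x) = a \<odot>\<^bsub>N\<^esub> h x"
  using assms by (auto simp: mod_hom_def)

lemma mod_hom_comp:
  assumes "g \<in> mod_hom R L M" "h \<in> mod_hom R M N"
  shows "h \<circ> g \<in> mod_hom R L N"
  using assms by (auto simp: mod_hom_def Pi_iff)

section \<open>Arithmetic in a left module and its submodules\<close>

context left_module
begin

lemma smult_l_null [simp]:
  assumes "x \<in> carrier M" shows "\<zero>\<^bsub>R\<^esub> \<odot>\<^bsub>M\<^esub> x = \<zero>\<^bsub>M\<^esub>"
  using smult_l_distr[of "\<zero>\<^bsub>R\<^esub>" "\<zero>\<^bsub>R\<^esub>" x] assms by (simp add: M.add.r_cancel_one')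

lemma smult_r_null [simp]:
  assumes "a \<in> carrier R" shows "a \<odot>\<^bsub>M\<^esub> \<zero>\<^bsub>M\<^esub> = \<zero>\<^bsub>M\<^esub>"
  using smult_r_distr[of a "\<zero>\<^bsub>M\<^esub>" "\<zero>\<^bsub>M\<^esub>"] assms by (simp add: M.add.r_cancel_one')

text \<open>Adding \<open>x\<close> gives \<open>(-1 + 1) x\<close>, which is zero, and additive
  inverses are unique. Negation thereby becomes a scalar multiplication, which homomorphisms and
  submodules respect by definition.\<close>

lemma smult_minus_one:
  assumes "x \<in> carrier M" shows "(\<ominus>\<^bsub>R\<^esub> \<one>\<^bsub>R\<^esub>) \<odot>\<^bsub>M\<^esub> x = \<ominus>\<^bsub>M\<^esub> x"
proof -
  have "(\<ominus>\<^bsub>R\<^esub> \<one>\<^bsub>R\<^esub>) \<odot>\<^bsub>M\<^esub> x \<oplus>\<^bsub>M\<^esub> x = (\<ominus>\<^bsub>R\<^esub> \<one>\<^bsub>R\<^esub> \<oplus>\<^bsub>R\<^esub> \<one>\<^bsub>R\<^esub>) \<odot>\<^bsub>M\<^esub> x"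
    using assms by (subst smult_l_distr) auto
  also have "\<dots> = \<zero>\<^bsub>M\<^esub>" using assms by (simp add: R.l_neg)
  finally show ?thesis using assms by (simp add: M.minus_equality)
qed

lemma finsum_smult:
  assumes "finite A" "a \<in> carrier R" "f \<in> A \<rightarrow> carrier M"
  shows "a \<odot>\<^bsub>M\<^esub> (\<Oplus>\<^bsub>M\<^esub>i\<in>A. f i) = (\<Oplus>\<^bsub>M\<^esub>i\<in>A. a \<odot>\<^bsub>M\<^esub> f i)"
  using assms by (induct set: finite) (simp_all add: Pi_def smult_r_distr)

text \<open>Closure under negation, which the locale \<open>submodule\<close> demands, comes from
  closure under the scalar \<open>-1\<close>.\<close>

lemma submoduleI':
  assumes "S \<subseteq> carrier M" "\<zero>\<^bsub>M\<^esub> \<in> S"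
    and "\<And>x y. \<lbrakk>x \<in> S; y \<in> S\<rbrakk> \<Longrightarrow> x \<oplus>\<^bsub>M\<^esub> y \<in> S"
    and sm: "\<And>a x. \<lbrakk>a \<in> carrier R; x \<in> S\<rbrakk> \<Longrightarrow> a \<odot>\<^bsub>M\<^esub> x \<in> S"
  shows "submodule S R M"
proof (intro submodule.intro submodule_axioms.intro M.add.subgroupI)
  fix x assume "x \<in> S"
  then show "\<ominus>\<^bsub>M\<^esub> x \<in> S"
    using sm[of "\<ominus>\<^bsub>R\<^esub> \<one>\<^bsub>R\<^esub>" x] assms(1) smult_minus_one by auto
qed (use assms in auto)

lemma submodule_left_module:
  assumes "submodule S R M" shows "left_module R (M\<lparr>carrier := S\<rparr>)"
proof -
  interpret S: submodule S R M by fact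
  have sub: "\<And>x. x \<in> S \<Longrightarrow> x \<in> carrier M" using S.subset by auto
  have "abelian_group (M\<lparr>carrier := S\<rparr>)"
  proof (rule abelian_groupI)
    fix x assume x: "x \<in> carrier (M\<lparr>carrier := S\<rparr>)"
    then have "\<ominus>\<^bsub>M\<^esub> x \<in> S"
      using S.smult_closed[of "\<ominus>\<^bsub>R\<^esub> \<one>\<^bsub>R\<^esub>" x] smult_minus_one[of x] sub by simp
    with x sub show "\<exists>y\<in>carrier (M\<lparr>carrier := S\<rparr>). y \<oplus>\<^bsub>M\<lparr>carrier := S\<rparr>\<^esub> x = \<zero>\<^bsub>M\<lparr>carrier := S\<rparr>\<^esub>"
      by (intro bexI[of _ "\<ominus>\<^bsub>M\<^esub> x"]) (simp_all add: M.l_neg)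
  qed (use S.m_closed S.one_closed in \<open>auto simp: sub M.a_ac\<close>)
  then show ?thesis
    by (intro left_module.intro left_module_axioms.intro R.ring_axioms)
      (auto simp: sub smult_l_distr smult_r_distr smult_assoc1)
qed

lemma submodule_inclusion_hom:
  assumes "submodule S R M" shows "(\<lambda>x. x) \<in> mod_hom R (M\<lparr>carrier := S\<rparr>) M"
proof -
  interpret S: submodule S R M by fact
  show ?thesis using S.subset by (auto simp: mod_hom_def)
qed

end

section \<open>Homomorphisms: linear combinations, kernels, inverses\<close>

lemma mod_hom_zero:
  assumes "left_module R M" "left_module R N" "h \<in> mod_hom R M N"
  shows "h \<zero>\<^bsub>M\<^esub> = \<zero>\<^bsub>N\<^esub>"
proof -
  interpret M: left_module R M by fact
  interpret N: left_module R N by fact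
  have "h (\<zero>\<^bsub>R\<^esub> \<odot>\<^bsub>M\<^esub> \<zero>\<^bsub>M\<^esub>) = \<zero>\<^bsub>R\<^esub> \<odot>\<^bsub>N\<^esub> h \<zero>\<^bsub>M\<^esub>"
    by (rule mod_homD(3)[OF assms(3)]) simp_all
  then show ?thesis using mod_homD(1)[OF assms(3)] by simp
qed

lemma mod_hom_finsum:
  assumes "left_module R M" "left_module R N" and h: "h \<in> mod_hom R M N"
    and "finite A" "f \<in> A \<rightarrow> carrier M"
  shows "h (\<Oplus>\<^bsub>M\<^esub>i\<in>A. f i) = (\<Oplus>\<^bsub>N\<^esub>i\<in>A. h (f i))"
proof -
  interpret M: left_module R M by fact
  interpret N: left_module R N by fact
  show ?thesis using assms(4,5)
    by (induct set: finite) (simp_all add: mod_hom_zero[OF assms(1-3)] mod_homD[OF h] Pi_def)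
qed

text \<open>The vectors form a family \<open>f\<close> instead of being the indices themselves, so
  that the lemma also covers lifts of basis elements that are indexed by the basis of another
  module.\<close>

lemma mod_hom_lincomb:
  assumes "left_module R M" "left_module R N" and h: "h \<in> mod_hom R M N"
    and "finite A" and c: "c \<in> A \<rightarrow> carrier R" and f: "f \<in> A \<rightarrow> carrier M"
  shows "h (\<Oplus>\<^bsub>M\<^esub>i\<in>A. c i \<odot>\<^bsub>M\<^esub> f i) = (\<Oplus>\<^bsub>N\<^esub>i\<in>A. c i \<odot>\<^bsub>N\<^esub> h (f i))"
proof -
  interpret M: left_module R M by fact
  interpret N: left_module R N by fact
  have "h (\<Oplus>\<^bsub>M\<^esub>i\<in>A. c i \<odot>\<^bsub>M\<^esub> f i) = (\<Oplus>\<^bsub>N\<^esub>i\<in>A. h (c i \<odot>\<^bsub>M\<^esub> f i))"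
    by (rule mod_hom_finsum[OF assms(1-4)]) (use c f in auto)
  also have "\<dots> = (\<Oplus>\<^bsub>N\<^esub>i\<in>A. c i \<odot>\<^bsub>N\<^esub> h (f i))"
    using c f h by (intro N.M.finsum_cong') (auto simp: mod_homD[OF h] Pi_iff)
  finally show ?thesis .
qed

lemma mod_hom_inj_onI:
  assumes "left_module R M" "left_module R N" and h: "h \<in> mod_hom R M N"
    and ker: "\<And>x. \<lbrakk>x \<in> carrier M; h x = \<zero>\<^bsub>N\<^esub>\<rbrakk> \<Longrightarrow> x = \<zero>\<^bsub>M\<^esub>"
  shows "inj_on h (carrier M)"
proof (rule inj_onI)
  interpret M: left_module R M by fact
  interpret N: left_module R N by fact
  fix x y assume x: "x \<in> carrier M" and y: "y \<in> carrier M" and e: "h x = h y"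
  \<comment> \<open>The negative of \<open>y\<close> is written as a scalar multiple, so that
    linearity of \<open>h\<close> applies to the difference of \<open>x\<close> and \<open>y\<close>
    directly.\<close>
  let ?y = "(\<ominus>\<^bsub>R\<^esub> \<one>\<^bsub>R\<^esub>) \<odot>\<^bsub>M\<^esub> y"
  have "h (x \<oplus>\<^bsub>M\<^esub> ?y) = h x \<oplus>\<^bsub>N\<^esub> (\<ominus>\<^bsub>R\<^esub> \<one>\<^bsub>R\<^esub>) \<odot>\<^bsub>N\<^esub> h y"
    using x y by (simp add: mod_homD[OF h] M.smult_closed)
  also have "\<dots> = \<zero>\<^bsub>N\<^esub>"
    using y by (simp add: e N.smult_minus_one mod_homD[OF h] N.M.r_neg)
  finally have "x \<oplus>\<^bsub>M\<^esub> ?y = \<zero>\<^bsub>M\<^esub>" using x y by (intro ker) (auto simp: M.smult_closed)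
  then have "x \<oplus>\<^bsub>M\<^esub> \<ominus>\<^bsub>M\<^esub> y = \<zero>\<^bsub>M\<^esub>" using y by (simp add: M.smult_minus_one)
  then show "x = y" using x y
    by (metis M.M.add.inv_closed M.M.minus_equality M.M.minus_minus)
qed

lemma mod_iso_inv_into:
  assumes "left_module R M" and h: "h \<in> mod_iso R M N"
  shows "inv_into (carrier M) h \<in> mod_iso R N M"
proof -
  interpret M: left_module R M by fact
  have hom: "h \<in> mod_hom R M N" and b: "bij_betw h (carrier M) (carrier N)"
    using h by (auto simp: mod_iso_def)
  let ?g = "inv_into (carrier M) h"
  have g: "?g y \<in> carrier M" "h (?g y) = y" if "y \<in> carrier N" for y
    using that b by (auto simp: bij_betw_def inv_into_into f_inv_into_f)
  have gh: "?g (h x) = x" if "x \<in> carrier M" for x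
    using that b by (auto simp: bij_betw_def)
  \<comment> \<open>By linearity \<open>h\<close> maps the right side to the argument of
    \<open>?g\<close> on the left; applying \<open>?g\<close> and cancelling with \<open>gh\<close>
    gives the claim. Scalars are treated in the same way.\<close>
  have "?g (x \<oplus>\<^bsub>N\<^esub> y) = ?g x \<oplus>\<^bsub>M\<^esub> ?g y" if "x \<in> carrier N" "y \<in> carrier N" for x y
    using gh[of "?g x \<oplus>\<^bsub>M\<^esub> ?g y"] that by (simp add: g mod_homD[OF hom])
  moreover have "?g (a \<odot>\<^bsub>N\<^esub> x) = a \<odot>\<^bsub>M\<^esub> ?g x" if "a \<in> carrier R" "x \<in> carrier N" for a x
    using gh[of "a \<odot>\<^bsub>M\<^esub> ?g x"] that by (simp add: g mod_homD[OF hom] M.smult_closed)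
  ultimately show ?thesis
    using bij_betw_inv_into[OF b] g by (auto simp: mod_iso_def mod_hom_def)
qed

section \<open>Generation, independence and freeness under isomorphisms\<close>

text \<open>A preimage is expanded in \<open>B\<close> and the expansion is mapped term by term.
  Combinations are indexed by the vectors themselves, so the result must still be reindexed along
  \<open>h\<close>.\<close>

lemma generates_image:
  assumes M: "left_module R M" and N: "left_module R N" and iso: "h \<in> mod_iso R M N"
    and B: "generates R M B"
  shows "generates R N (h ` B)"
  unfolding generates_def
proof (intro conjI ballI)
  interpret N: left_module R N by fact
  have h: "h \<in> mod_hom R M N" and b: "bij_betw h (carrier M) (carrier N)"
    using iso by (auto simp: mod_iso_def)
  have sub: "B \<subseteq> carrier M" using B by (simp add: generates_def)
  then show "h ` B \<subseteq> carrier N" using mod_homD(1)[OF h] by auto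
  fix y assume "y \<in> carrier N"
  then obtain x where x: "x \<in> carrier M" "y = h x" using b by (auto simp: bij_betw_def)
  then obtain A c where A: "finite A" "A \<subseteq> B" "c \<in> A \<rightarrow> carrier R"
    and xs: "x = (\<Oplus>\<^bsub>M\<^esub>b\<in>A. c b \<odot>\<^bsub>M\<^esub> b)"
    using B unfolding generates_def by blast
  have inj: "inj_on h A" using b A sub by (auto simp: bij_betw_def intro: inj_on_subset)
  have hA: "\<And>b. b \<in> A \<Longrightarrow> h b \<in> carrier N" using A sub mod_homD(1)[OF h] by auto
  let ?c = "\<lambda>z. c (inv_into A h z)"
  have "y = (\<Oplus>\<^bsub>N\<^esub>b\<in>A. c b \<odot>\<^bsub>N\<^esub> h b)"
    unfolding x xs using A sub by (intro mod_hom_lincomb[OF M N h]) auto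
  also have "\<dots> = (\<Oplus>\<^bsub>N\<^esub>b\<in>A. ?c (h b) \<odot>\<^bsub>N\<^esub> h b)"
    using A hA inj by (intro N.M.finsum_cong') (auto intro!: N.smult_closed)
  also have "\<dots> = (\<Oplus>\<^bsub>N\<^esub>z\<in>h ` A. ?c z \<odot>\<^bsub>N\<^esub> z)"
    using A hA inj by (intro N.M.finsum_reindex[symmetric]) (auto intro!: N.smult_closed)
  finally have "y = (\<Oplus>\<^bsub>N\<^esub>z\<in>h ` A. ?c z \<odot>\<^bsub>N\<^esub> z)" .
  moreover have "?c \<in> h ` A \<rightarrow> carrier R" using A inj by auto
  ultimately show "\<exists>A c. finite A \<and> A \<subseteq> h ` B \<and> c \<in> A \<rightarrow> carrier R \<and>
      y = (\<Oplus>\<^bsub>N\<^esub>b\<in>A. c b \<odot>\<^bsub>N\<^esub> b)"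
    using A by (intro exI[of _ "h ` A"] exI[of _ ?c]) auto
qed

text \<open>A relation among images is pulled back to a relation in \<open>M\<close>: its left side
  is mapped to zero, hence vanishes because \<open>h\<close> is injective, and independence of
  \<open>B\<close> applies.\<close>

lemma independent_image:
  assumes M: "left_module R M" and N: "left_module R N" and iso: "h \<in> mod_iso R M N"
    and B: "independent R M B"
  shows "independent R N (h ` B)"
  unfolding independent_def
proof (intro conjI allI impI ballI)
  interpret M: left_module R M by fact
  interpret N: left_module R N by fact
  have h: "h \<in> mod_hom R M N" and b: "bij_betw h (carrier M) (carrier N)"
    using iso by (auto simp: mod_iso_def)
  have sub: "B \<subseteq> carrier M" using B by (simp add: independent_def)
  then show "h ` B \<subseteq> carrier N" using mod_homD(1)[OF h] by auto
  fix A c z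
  assume "finite A \<and> A \<subseteq> h ` B \<and> c \<in> A \<rightarrow> carrier R \<and> (\<Oplus>\<^bsub>N\<^esub>b\<in>A. c b \<odot>\<^bsub>N\<^esub> b) = \<zero>\<^bsub>N\<^esub>"
    and z: "z \<in> A"
  then have A: "finite A" "A \<subseteq> h ` B" "c \<in> A \<rightarrow> carrier R"
    and s: "(\<Oplus>\<^bsub>N\<^esub>b\<in>A. c b \<odot>\<^bsub>N\<^esub> b) = \<zero>\<^bsub>N\<^esub>" by auto
  \<comment> \<open>The support of the relation is replaced by a finite set of preimages inside
    \<open>B\<close>.\<close>
  obtain C where C: "C \<subseteq> B" "finite C" "A = h ` C"
    using finite_subset_image[OF A(1,2)] by blast
  have inj: "inj_on h C" using b C sub by (auto simp: bij_betw_def intro: inj_on_subset)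
  have hC: "\<And>b. b \<in> C \<Longrightarrow> h b \<in> carrier N" using C sub mod_homD(1)[OF h] by auto
  let ?x = "\<Oplus>\<^bsub>M\<^esub>b\<in>C. c (h b) \<odot>\<^bsub>M\<^esub> b"
  have xM: "?x \<in> carrier M" using A C sub by (intro M.M.finsum_closed) (auto intro!: M.smult_closed)
  have "h ?x = (\<Oplus>\<^bsub>N\<^esub>b\<in>C. c (h b) \<odot>\<^bsub>N\<^esub> h b)"
    using A C sub by (intro mod_hom_lincomb[OF M N h]) auto
  also have "\<dots> = (\<Oplus>\<^bsub>N\<^esub>b\<in>A. c b \<odot>\<^bsub>N\<^esub> b)"
    unfolding C(3) using A C hC inj
    by (intro N.M.finsum_reindex[symmetric]) (auto intro!: N.smult_closed)
  finally have "h ?x = h \<zero>\<^bsub>M\<^esub>" using s mod_hom_zero[OF M N h] by simp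
  then have "?x = \<zero>\<^bsub>M\<^esub>" using b xM by (auto simp: bij_betw_def dest: inj_onD)
  moreover have "(\<lambda>b. c (h b)) \<in> C \<rightarrow> carrier R" using A C by auto
  ultimately have "\<forall>b\<in>C. c (h b) = \<zero>\<^bsub>R\<^esub>"
    using B C unfolding independent_def by blast
  then show "c z = \<zero>\<^bsub>R\<^esub>" using z C by auto
qed

lemma mod_iso_fin_gen_iff:
  assumes "left_module R M" "left_module R N" "h \<in> mod_iso R M N"
  shows "fin_gen R M \<longleftrightarrow> fin_gen R N"
  unfolding fin_gen_def
  using generates_image[OF assms] generates_image[OF assms(2,1) mod_iso_inv_into[OF assms(1,3)]]
  by (metis finite_imageI)

lemma mod_iso_free_iff:
  assumes "left_module R M" "left_module R N" "h \<in> mod_iso R M N"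
  shows "free_module R M \<longleftrightarrow> free_module R N"
  unfolding free_module_def
  using generates_image[OF assms] independent_image[OF assms]
    generates_image[OF assms(2,1) mod_iso_inv_into[OF assms(1,3)]]
    independent_image[OF assms(2,1) mod_iso_inv_into[OF assms(1,3)]]
  by metis

section \<open>Images of submodules\<close>

lemma submodule_image:
  assumes M: "left_module R M" and N: "left_module R N" and h: "h \<in> mod_hom R M N"
    and S: "submodule S R M"
  shows "submodule (h ` S) R N"
proof -
  interpret M: left_module R M by fact
  interpret N: left_module R N by fact
  interpret S: submodule S R M by fact
  have sub: "\<And>x. x \<in> S \<Longrightarrow> x \<in> carrier M" using S.subset by auto
  show ?thesis
  proof (rule N.submoduleI')
    show "h ` S \<subseteq> carrier N" using sub mod_homD(1)[OF h] by auto
    show "\<zero>\<^bsub>N\<^esub> \<in> h ` S" using S.one_closed mod_hom_zero[OF M N h] by force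
  next
    fix x y assume "x \<in> h ` S" "y \<in> h ` S"
    then obtain u v where "u \<in> S" "v \<in> S" "x = h u" "y = h v" by auto
    then have "x \<oplus>\<^bsub>N\<^esub> y = h (u \<oplus>\<^bsub>M\<^esub> v)" "u \<oplus>\<^bsub>M\<^esub> v \<in> S"
      using S.m_closed[of u v] sub by (simp_all add: mod_homD(2)[OF h])
    then show "x \<oplus>\<^bsub>N\<^esub> y \<in> h ` S" by blast
  next
    fix a x assume a: "a \<in> carrier R" and "x \<in> h ` S"
    then obtain u where "u \<in> S" "x = h u" by auto
    then have "a \<odot>\<^bsub>N\<^esub> x = h (a \<odot>\<^bsub>M\<^esub> u)" "a \<odot>\<^bsub>M\<^esub> u \<in> S"
      using a S.smult_closed[of a u] sub by (simp_all add: mod_homD(3)[OF h])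
    then show "a \<odot>\<^bsub>N\<^esub> x \<in> h ` S" by blast
  qed
qed

text \<open>Restricting the target to the image supplies surjectivity. Finite generation and
  freeness can then be compared between a submodule and its injective image.\<close>

lemma mod_iso_submodule_image:
  assumes M: "left_module R M" and h: "h \<in> mod_hom R M N"
    and S: "submodule S R M" and inj: "inj_on h S"
  shows "h \<in> mod_iso R (M\<lparr>carrier := S\<rparr>) (N\<lparr>carrier := h ` S\<rparr>)"
proof -
  interpret S: submodule S R M by fact
  have "\<And>x. x \<in> S \<Longrightarrow> x \<in> carrier M" using S.subset by auto
  then show ?thesis using inj mod_homD[OF h]
    by (auto simp: mod_iso_def mod_hom_def bij_betw_def)
qed

section \<open>Spans and lifts of free submodules\<close>

text \<open>Indexing by \<open>B\<close> instead of by the vectors \<open>s b\<close> lets the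
  coefficients of a combination of basis elements serve unchanged for their lifts.\<close>

definition span_of :: "('r, 'a) ring_scheme \<Rightarrow> ('r, 'm) module \<Rightarrow> ('b \<Rightarrow> 'm) \<Rightarrow> 'b set \<Rightarrow> 'm set"
  where "span_of R M s B =
    {(\<Oplus>\<^bsub>M\<^esub>b\<in>A. c b \<odot>\<^bsub>M\<^esub> s b) | A c. finite A \<and> A \<subseteq> B \<and> c \<in> A \<rightarrow> carrier R}"

lemma (in left_module) span_of_submodule:
  assumes s: "s \<in> B \<rightarrow> carrier M"
  shows "submodule (span_of R M s B) R M"
proof (rule submoduleI')
  have cl: "(\<lambda>b. c b \<odot>\<^bsub>M\<^esub> s b) \<in> A \<rightarrow> carrier M" if "A \<subseteq> B" "c \<in> A \<rightarrow> carrier R" for A c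
    using that s by (auto intro!: smult_closed)
  show "span_of R M s B \<subseteq> carrier M"
    using cl by (auto simp: span_of_def intro!: M.finsum_closed)
  show "\<zero>\<^bsub>M\<^esub> \<in> span_of R M s B"
    unfolding span_of_def by (rule CollectI, rule exI[of _ "{}"]) auto
  \<comment> \<open>Two combinations are added term by term over a common index set; padding the
    coefficients with zero extends each of them to the union of the supports.\<close>
  have ext: "(\<Oplus>\<^bsub>M\<^esub>b\<in>A. c b \<odot>\<^bsub>M\<^esub> s b) =
      (\<Oplus>\<^bsub>M\<^esub>b\<in>A'. (if b \<in> A then c b else \<zero>\<^bsub>R\<^esub>) \<odot>\<^bsub>M\<^esub> s b)"
    if "finite A'" "A \<subseteq> A'" "A' \<subseteq> B" "c \<in> A \<rightarrow> carrier R" for A A' c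
    using that s by (intro M.add.finprod_mono_neutral_cong_left) (auto simp: Pi_iff subset_iff)
  fix x y assume "x \<in> span_of R M s B" "y \<in> span_of R M s B"
  then obtain A c A' c' where A: "finite A" "A \<subseteq> B" "c \<in> A \<rightarrow> carrier R"
    and A': "finite A'" "A' \<subseteq> B" "c' \<in> A' \<rightarrow> carrier R"
    and x: "x = (\<Oplus>\<^bsub>M\<^esub>b\<in>A. c b \<odot>\<^bsub>M\<^esub> s b)" and y: "y = (\<Oplus>\<^bsub>M\<^esub>b\<in>A'. c' b \<odot>\<^bsub>M\<^esub> s b)"
    unfolding span_of_def by blast
  let ?d = "\<lambda>b. if b \<in> A then c b else \<zero>\<^bsub>R\<^esub>" and ?d' = "\<lambda>b. if b \<in> A' then c' b else \<zero>\<^bsub>R\<^esub>"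
  have d: "?d b \<in> carrier R" "?d' b \<in> carrier R" for b using A A' by auto
  have "x \<oplus>\<^bsub>M\<^esub> y = (\<Oplus>\<^bsub>M\<^esub>b\<in>A \<union> A'. ?d b \<odot>\<^bsub>M\<^esub> s b) \<oplus>\<^bsub>M\<^esub> (\<Oplus>\<^bsub>M\<^esub>b\<in>A \<union> A'. ?d' b \<odot>\<^bsub>M\<^esub> s b)"
    unfolding x y using ext[of "A \<union> A'" A c] ext[of "A \<union> A'" A' c'] A A' by simp
  also have "\<dots> = (\<Oplus>\<^bsub>M\<^esub>b\<in>A \<union> A'. ?d b \<odot>\<^bsub>M\<^esub> s b \<oplus>\<^bsub>M\<^esub> ?d' b \<odot>\<^bsub>M\<^esub> s b)"
    using A A' d by (intro M.finsum_addf[symmetric] cl) blast+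
  also have "\<dots> = (\<Oplus>\<^bsub>M\<^esub>b\<in>A \<union> A'. (?d b \<oplus>\<^bsub>R\<^esub> ?d' b) \<odot>\<^bsub>M\<^esub> s b)"
  proof (rule M.finsum_cong'[OF refl])
    show "(\<lambda>b. (?d b \<oplus>\<^bsub>R\<^esub> ?d' b) \<odot>\<^bsub>M\<^esub> s b) \<in> A \<union> A' \<rightarrow> carrier M"
      using A A' d by (intro cl) blast+
    fix b assume "b \<in> A \<union> A'"
    then have "s b \<in> carrier M" using A A' s by blast
    then show "?d b \<odot>\<^bsub>M\<^esub> s b \<oplus>\<^bsub>M\<^esub> ?d' b \<odot>\<^bsub>M\<^esub> s b = (?d b \<oplus>\<^bsub>R\<^esub> ?d' b) \<odot>\<^bsub>M\<^esub> s b"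
      by (rule smult_l_distr[OF d, symmetric])
  qed
  finally show "x \<oplus>\<^bsub>M\<^esub> y \<in> span_of R M s B"
    unfolding span_of_def using A A' d
    by (intro CollectI exI[of _ "A \<union> A'"] exI[of _ "\<lambda>b. ?d b \<oplus>\<^bsub>R\<^esub> ?d' b"]) blast
next
  fix a x assume a: "a \<in> carrier R" and "x \<in> span_of R M s B"
  then obtain A c where A: "finite A" "A \<subseteq> B" "c \<in> A \<rightarrow> carrier R"
    and x: "x = (\<Oplus>\<^bsub>M\<^esub>b\<in>A. c b \<odot>\<^bsub>M\<^esub> s b)"
    unfolding span_of_def by blast
  have cs: "c b \<in> carrier R" "s b \<in> carrier M" if "b \<in> A" for b using that A s by auto
  have "a \<odot>\<^bsub>M\<^esub> x = (\<Oplus>\<^bsub>M\<^esub>b\<in>A. a \<odot>\<^bsub>M\<^esub> (c b \<odot>\<^bsub>M\<^esub> s b))"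
    unfolding x using A a cs by (intro finsum_smult) auto
  also have "\<dots> = (\<Oplus>\<^bsub>M\<^esub>b\<in>A. (a \<otimes>\<^bsub>R\<^esub> c b) \<odot>\<^bsub>M\<^esub> s b)"
    using a cs by (intro M.finsum_cong') (auto simp: smult_assoc1)
  finally show "a \<odot>\<^bsub>M\<^esub> x \<in> span_of R M s B"
    unfolding span_of_def using A a cs
    by (intro CollectI exI[of _ A] exI[of _ "\<lambda>b. a \<otimes>\<^bsub>R\<^esub> c b"]) auto
qed

lemma free_submodule_lift:
  assumes M: "left_module R M" and N: "left_module R N" and h: "h \<in> mod_hom R M N"
    and U: "submodule U R N" and onto: "U \<subseteq> h ` carrier M"
    and free: "free_module R (N\<lparr>carrier := U\<rparr>)"
  obtains S where "submodule S R M" "inj_on h S" "h ` S = U"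
proof -
  interpret M: left_module R M by fact
  interpret N: left_module R N by fact
  have NU: "left_module R (N\<lparr>carrier := U\<rparr>)" by (rule N.submodule_left_module[OF U])
  note incl = N.submodule_inclusion_hom[OF U]
  obtain B where gen: "generates R (N\<lparr>carrier := U\<rparr>) B"
    and ind: "independent R (N\<lparr>carrier := U\<rparr>) B"
    using free unfolding free_module_def by blast
  have B: "B \<subseteq> U" using gen by (simp add: generates_def)
  \<comment> \<open>An arbitrary choice of preimages; linearity is not asked of
    \<open>s\<close>.\<close>
  define s where "s = inv_into (carrier M) h"
  have s: "s b \<in> carrier M" "h (s b) = b" if "b \<in> B" for b
    using that B onto unfolding s_def by (auto intro: inv_into_into f_inv_into_f)
  define S where "S = span_of R M s B"
  have S: "submodule S R M" unfolding S_def using s by (intro M.span_of_submodule) auto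
  have comb: "h (\<Oplus>\<^bsub>M\<^esub>b\<in>A. c b \<odot>\<^bsub>M\<^esub> s b) = (\<Oplus>\<^bsub>N\<lparr>carrier := U\<rparr>\<^esub>b\<in>A. c b \<odot>\<^bsub>N\<lparr>carrier := U\<rparr>\<^esub> b)"
    if A: "finite A" "A \<subseteq> B" "c \<in> A \<rightarrow> carrier R" for A c
  proof -
    have "h (\<Oplus>\<^bsub>M\<^esub>b\<in>A. c b \<odot>\<^bsub>M\<^esub> s b) = (\<Oplus>\<^bsub>N\<^esub>b\<in>A. c b \<odot>\<^bsub>N\<^esub> h (s b))"
      using A s by (intro mod_hom_lincomb[OF M N h]) auto
    also have "\<dots> = (\<Oplus>\<^bsub>N\<^esub>b\<in>A. c b \<odot>\<^bsub>N\<^esub> b)"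
      using A s mod_homD(1)[OF h] by (intro N.M.finsum_cong') (auto intro!: N.smult_closed, force)
    \<comment> \<open>The sum is moved into \<open>U\<close>, where the basis properties are stated,
      because the inclusion of \<open>U\<close> preserves linear combinations.\<close>
    also have "\<dots> = (\<Oplus>\<^bsub>N\<lparr>carrier := U\<rparr>\<^esub>b\<in>A. c b \<odot>\<^bsub>N\<lparr>carrier := U\<rparr>\<^esub> b)"
      using A B by (intro mod_hom_lincomb[OF NU N incl, symmetric]) auto
    finally show ?thesis .
  qed
  have "h ` S = U"
  proof
    show "h ` S \<subseteq> U"
    proof
      fix y assume "y \<in> h ` S"
      then obtain A c where A: "finite A" "A \<subseteq> B" "c \<in> A \<rightarrow> carrier R"
        and y: "y = h (\<Oplus>\<^bsub>M\<^esub>b\<in>A. c b \<odot>\<^bsub>M\<^esub> s b)"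
        unfolding S_def span_of_def by blast
      interpret NU: left_module R "N\<lparr>carrier := U\<rparr>" by fact
      have "(\<Oplus>\<^bsub>N\<lparr>carrier := U\<rparr>\<^esub>b\<in>A. c b \<odot>\<^bsub>N\<lparr>carrier := U\<rparr>\<^esub> b) \<in> carrier (N\<lparr>carrier := U\<rparr>)"
        using A B by (intro NU.M.finsum_closed) (auto intro!: submodule.smult_closed[OF U])
      then show "y \<in> U" unfolding y comb[OF A] by simp
    qed
    show "U \<subseteq> h ` S"
    proof
      fix y assume "y \<in> U"
      then obtain A c where A: "finite A" "A \<subseteq> B" "c \<in> A \<rightarrow> carrier R"
        and y: "y = (\<Oplus>\<^bsub>N\<lparr>carrier := U\<rparr>\<^esub>b\<in>A. c b \<odot>\<^bsub>N\<lparr>carrier := U\<rparr>\<^esub> b)"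
        using gen unfolding generates_def by force
      show "y \<in> h ` S" unfolding y comb[OF A, symmetric] S_def span_of_def using A by blast
    qed
  qed
  moreover have "inj_on h (carrier (M\<lparr>carrier := S\<rparr>))"
  proof (rule mod_hom_inj_onI[OF M.submodule_left_module[OF S] N])
    show "h \<in> mod_hom R (M\<lparr>carrier := S\<rparr>) N"
      using mod_hom_comp[OF M.submodule_inclusion_hom[OF S] h] by (simp add: comp_def)
    fix x assume "x \<in> carrier (M\<lparr>carrier := S\<rparr>)" and hx: "h x = \<zero>\<^bsub>N\<^esub>"
    then obtain A c where A: "finite A" "A \<subseteq> B" "c \<in> A \<rightarrow> carrier R"
      and x: "x = (\<Oplus>\<^bsub>M\<^esub>b\<in>A. c b \<odot>\<^bsub>M\<^esub> s b)"
      unfolding S_def span_of_def by auto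
    \<comment> \<open>By \<open>comb\<close>, the vanishing of \<open>h x\<close> is a linear
      relation among basis elements of \<open>U\<close> with the coefficients of
      \<open>x\<close>.\<close>
    have "\<forall>b\<in>A. c b = \<zero>\<^bsub>R\<^esub>"
      using ind A comb[OF A] hx unfolding independent_def x by simp
    then have "x = (\<Oplus>\<^bsub>M\<^esub>b\<in>A. \<zero>\<^bsub>M\<^esub>)"
      unfolding x using A s by (intro M.M.finsum_cong') auto
    then show "x = \<zero>\<^bsub>M\<lparr>carrier := S\<rparr>\<^esub>" by simp
  qed
  ultimately show thesis using S that by simp
qed

section \<open>Pullback of quadratic forms and split preformations\<close>

text \<open>Each condition on \<open>M\<close> is the condition on \<open>N\<close> evaluated at
  values of \<open>h\<close>. The second argument is restricted to \<open>carrier M\<close> because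
  elements of the dual are extensional.\<close>

lemma quadratic_form_pullback:
  assumes q: "quadratic_form R bar e N \<phi> \<nu>" and M: "left_module R M" and h: "h \<in> mod_hom R M N"
  shows "quadratic_form R bar e M (\<lambda>x. \<lambda>y\<in>carrier M. \<phi> (h x) (h y)) (\<nu> \<circ> h)"
proof -
  interpret M: left_module R M by fact
  let ?\<phi> = "\<lambda>x. \<lambda>y\<in>carrier M. \<phi> (h x) (h y)"
  have \<phi>: "\<phi> \<in> mod_hom R N (dual R bar N)"
    and ad: "\<And>x. x \<in> carrier N \<Longrightarrow> \<phi> x = e \<odot>\<^bsub>dual R bar N\<^esub> adjoint bar N \<phi> x"
    using q by (auto simp: quadratic_form_def)
  note hD = mod_homD[OF h]
  have \<phi>D: "\<phi> x \<in> mod_hom R N (ring_as_mod R)" if "x \<in> carrier N" for x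
    using mod_homD(1)[OF \<phi> that] by (simp add: dual_def)
  have \<phi>_y: "\<phi> x y \<in> carrier R"
      "z \<in> carrier N \<Longrightarrow> \<phi> x (y \<oplus>\<^bsub>N\<^esub> z) = \<phi> x y \<oplus>\<^bsub>R\<^esub> \<phi> x z"
      "a \<in> carrier R \<Longrightarrow> \<phi> x (a \<odot>\<^bsub>N\<^esub> y) = a \<otimes>\<^bsub>R\<^esub> \<phi> x y"
    if "x \<in> carrier N" "y \<in> carrier N" for x y z a
    using mod_homD[OF \<phi>D[OF that(1)]] that by (auto simp: ring_as_mod_def)
  have \<phi>_x: "z \<in> carrier N \<Longrightarrow> \<phi> (x \<oplus>\<^bsub>N\<^esub> y) z = \<phi> x z \<oplus>\<^bsub>R\<^esub> \<phi> y z"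
    if "x \<in> carrier N" "y \<in> carrier N" for x y z
    using mod_homD(2)[OF \<phi> that] by (simp add: dual_def)
  have \<phi>_ax: "\<phi> (a \<odot>\<^bsub>N\<^esub> x) z = \<phi> x z \<otimes>\<^bsub>R\<^esub> bar a"
    if "a \<in> carrier R" "x \<in> carrier N" "z \<in> carrier N" for a x z
    using mod_homD(3)[OF \<phi> that(1,2)] that(3) by (simp add: dual_def)
  have "?\<phi> \<in> mod_hom R M (dual R bar M)"
  proof -
    have "?\<phi> x \<in> carrier (dual R bar M)" if "x \<in> carrier M" for x
      using that by (auto simp: dual_def mod_hom_def ring_as_mod_def hD \<phi>_y)
    moreover have "?\<phi> (x \<oplus>\<^bsub>M\<^esub> y) = ?\<phi> x \<oplus>\<^bsub>dual R bar M\<^esub> ?\<phi> y"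
      if "x \<in> carrier M" "y \<in> carrier M" for x y
      using that by (auto simp: dual_def hD \<phi>_x intro!: restrict_ext)
    moreover have "?\<phi> (a \<odot>\<^bsub>M\<^esub> x) = a \<odot>\<^bsub>dual R bar M\<^esub> ?\<phi> x"
      if "a \<in> carrier R" "x \<in> carrier M" for a x
      using that by (auto simp: dual_def hD \<phi>_ax intro!: restrict_ext)
    ultimately show ?thesis unfolding mod_hom_def by blast
  qed
  moreover have "?\<phi> x = e \<odot>\<^bsub>dual R bar M\<^esub> adjoint bar M ?\<phi> x" if x: "x \<in> carrier M" for x
  proof -
    \<comment> \<open>Scalars act on the dual by right multiplication with their conjugate; this is
      the symmetry of \<open>\<phi>\<close> on \<open>N\<close> at the point
      \<open>h y\<close>.\<close>
    have "\<phi> (h x) (h y) = bar (\<phi> (h y) (h x)) \<otimes>\<^bsub>R\<^esub> bar e" if "y \<in> carrier M" for y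
      using fun_cong[OF ad[of "h x"], of "h y"] x that by (simp add: dual_def adjoint_def hD)
    then show ?thesis using x by (auto simp: dual_def adjoint_def intro!: restrict_ext)
  qed
  moreover have "\<nu> \<circ> h \<in> carrier M \<rightarrow> carrier (Q_group R bar e)"
    and "\<forall>x\<in>carrier M. \<forall>y\<in>carrier M.
        (\<nu> \<circ> h) (x \<oplus>\<^bsub>M\<^esub> y) \<otimes>\<^bsub>Q_group R bar e\<^esub> inv\<^bsub>Q_group R bar e\<^esub> (\<nu> \<circ> h) x
          \<otimes>\<^bsub>Q_group R bar e\<^esub> inv\<^bsub>Q_group R bar e\<^esub> (\<nu> \<circ> h) y = Q_class R bar e (?\<phi> x y)"
    and "\<forall>x\<in>carrier M. Q_symm R bar e ((\<nu> \<circ> h) x) = ?\<phi> x x"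
    and "\<forall>a\<in>carrier R. \<forall>x\<in>carrier M. (\<nu> \<circ> h) (a \<odot>\<^bsub>M\<^esub> x) = Q_conj R bar e a ((\<nu> \<circ> h) x)"
    using q unfolding quadratic_form_def by (simp_all add: hD Pi_iff)
  ultimately show ?thesis
    using q M unfolding quadratic_form_def by blast
qed

text \<open>The adjoint evaluates the form on the carrier alone, and the other conditions are
  quantified over the carrier as well.\<close>

lemma quadratic_form_cong:
  assumes "quadratic_form R bar e M \<phi> \<nu>" "left_module R M"
    and eq: "\<And>x. x \<in> carrier M \<Longrightarrow> \<phi> x = \<phi>' x"
  shows "quadratic_form R bar e M \<phi>' \<nu>"
proof -
  interpret M: left_module R M by fact
  have "\<phi>' \<in> mod_hom R M (dual R bar M)"
    using assms(1) eq by (auto simp: quadratic_form_def mod_hom_def Pi_iff)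
  moreover have "adjoint bar M \<phi> x = adjoint bar M \<phi>' x" if "x \<in> carrier M" for x
    using that eq by (auto simp: adjoint_def intro!: restrict_ext)
  ultimately show ?thesis
    using assms(1) eq unfolding quadratic_form_def by simp
qed

lemma split_preformation_pullback:
  assumes x: "split_preformation R bar \<epsilon> F H \<sigma> \<tau> \<psi>"
    and G: "left_module R G" "fin_gen R G" and p: "\<pi> \<in> mod_hom R G H"
  shows "split_preformation R bar \<epsilon> F G (\<sigma> \<circ> \<pi>) (\<tau> \<circ> \<pi>) (\<psi> \<circ> \<pi>)"
proof -
  have "quadratic_form R bar (\<ominus>\<^bsub>R\<^esub> \<epsilon>) G
      (\<lambda>x. \<lambda>y\<in>carrier G. (dual_map H \<sigma> \<circ> \<tau>) (\<pi> x) (\<pi> y)) (\<psi> \<circ> \<pi>)"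
    by (rule quadratic_form_pullback[OF _ G(1) p]) (use x in \<open>unfold split_preformation_def, blast\<close>)
  \<comment> \<open>Both forms take the value \<open>\<tau> (\<pi> x) (\<sigma> (\<pi> y))\<close>
    at \<open>x\<close> and \<open>y\<close> in \<open>G\<close>; the restriction to
    \<open>carrier H\<close> inside the pulled back form is harmless because \<open>\<pi> y\<close>
    lies there.\<close>
  then have "quadratic_form R bar (\<ominus>\<^bsub>R\<^esub> \<epsilon>) G (dual_map G (\<sigma> \<circ> \<pi>) \<circ> (\<tau> \<circ> \<pi>)) (\<psi> \<circ> \<pi>)"
    by (rule quadratic_form_cong)
      (use G mod_homD(1)[OF p] in \<open>auto simp: dual_map_def compose_def intro!: restrict_ext\<close>)
  moreover have "\<sigma> \<circ> \<pi> \<in> mod_hom R G F" "\<tau> \<circ> \<pi> \<in> mod_hom R G (dual R bar F)"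
    by (rule mod_hom_comp[OF p], use x in \<open>unfold split_preformation_def, blast\<close>)+
  ultimately show ?thesis
    using x G unfolding split_preformation_def by blast
qed

section \<open>Comparison of Lagrangians\<close>

text \<open>Equality of extensional functions on \<open>T\<close> is pointwise equality on
  \<open>T\<close>. This strips the restrictions and composites from the isotropy condition of a
  Lagrangian.\<close>

lemma dual_map_restrict_eq_zero_iff:
  assumes "T \<subseteq> carrier K"
  shows "dual_map (K\<lparr>carrier := T\<rparr>) (\<lambda>u. u) (dual_map K g f) = \<zero>\<^bsub>dual R bar (K\<lparr>carrier := T\<rparr>)\<^esub>
      \<longleftrightarrow> (\<forall>v\<in>T. f (g v) = \<zero>\<^bsub>R\<^esub>)"
proof -
  have "dual_map (K\<lparr>carrier := T\<rparr>) (\<lambda>u. u) (dual_map K g f) = (\<lambda>v\<in>T. f (g v))"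
    using assms by (auto simp: dual_map_def compose_def intro!: restrict_ext)
  moreover have "(\<lambda>v\<in>T. f (g v)) = (\<lambda>v\<in>T. \<zero>\<^bsub>R\<^esub>) \<longleftrightarrow> (\<forall>v\<in>T. f (g v) = \<zero>\<^bsub>R\<^esub>)"
  proof
    assume eq: "(\<lambda>v\<in>T. f (g v)) = (\<lambda>v\<in>T. \<zero>\<^bsub>R\<^esub>)"
    show "\<forall>v\<in>T. f (g v) = \<zero>\<^bsub>R\<^esub>"
      using fun_cong[OF eq] by (metis restrict_apply')
  qed (rule restrict_ext, blast)
  ultimately show ?thesis by (simp add: dual_def)
qed

text \<open>Either side says that \<open>\<tau> (\<pi> u) (\<sigma> (\<pi> v))\<close> is zero for
  all \<open>u\<close> and \<open>v\<close> in \<open>S\<close>.\<close>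

lemma vanishing_pullback_iff:
  assumes p: "\<pi> \<in> mod_hom R G H" and S: "S \<subseteq> carrier G"
  shows "(\<forall>u\<in>S. dual_map (G\<lparr>carrier := S\<rparr>) (\<lambda>u. u) (dual_map G (\<sigma> \<circ> \<pi>) ((\<tau> \<circ> \<pi>) u))
            = \<zero>\<^bsub>dual R bar (G\<lparr>carrier := S\<rparr>)\<^esub>) \<longleftrightarrow>
    (\<forall>u\<in>\<pi> ` S. dual_map (H\<lparr>carrier := \<pi> ` S\<rparr>) (\<lambda>u. u) (dual_map H \<sigma> (\<tau> u))
            = \<zero>\<^bsub>dual R bar (H\<lparr>carrier := \<pi> ` S\<rparr>)\<^esub>)"
proof -
  have "\<pi> ` S \<subseteq> carrier H" using mod_homD(1)[OF p] S by auto
  then show ?thesis by (simp add: dual_map_restrict_eq_zero_iff S)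
qed

lemma elementary_pullback_iff:
  assumes x: "split_preformation R bar \<epsilon> F H \<sigma> \<tau> \<psi>"
    and G: "left_module R G" "fin_gen R G"
    and p: "\<pi> \<in> mod_hom R G H" and onto: "\<pi> ` carrier G = carrier H"
  shows "elementary_preformation R bar \<epsilon> F H \<sigma> \<tau> \<psi> \<longleftrightarrow>
    elementary_preformation R bar \<epsilon> F G (\<sigma> \<circ> \<pi>) (\<tau> \<circ> \<pi>) (\<psi> \<circ> \<pi>)"
proof -
  interpret G: left_module R G by fact
  have H: "left_module R H" using x by (simp add: split_preformation_def)
  interpret H: left_module R H by (rule H)
  \<comment> \<open>\<open>lagr\<close> and \<open>lagr'\<close> collect the conditions on a
    Lagrangian of the preformation on \<open>H\<close> and of the one on \<open>G\<close>, in the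
    shape in which the definition of elementary states them.\<close>
  define lagr where "lagr U \<longleftrightarrow> submodule U R H \<and>
        fin_gen R (H\<lparr>carrier := U\<rparr>) \<and> free_module R (H\<lparr>carrier := U\<rparr>) \<and>
        (\<forall>u\<in>U. dual_map (H\<lparr>carrier := U\<rparr>) (\<lambda>u. u) (dual_map H \<sigma> (\<tau> u))
                 = \<zero>\<^bsub>dual R bar (H\<lparr>carrier := U\<rparr>)\<^esub>) \<and>
        (\<forall>u\<in>U. \<psi> u = \<one>\<^bsub>Q_group R bar (\<ominus>\<^bsub>R\<^esub> \<epsilon>)\<^esub>) \<and>
        inj_on \<sigma> U \<and> inj_on \<tau> U \<and>
        direct_summand R F (\<sigma> ` U) \<and> direct_summand R (dual R bar F) (\<tau> ` U) \<and>
        (\<lambda>C. the_elem ((\<lambda>f. restrict f (\<sigma> ` U)) ` C))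
          \<in> mod_iso R (quot_mod (dual R bar F) (\<tau> ` U))
                      (dual R bar (F\<lparr>carrier := \<sigma> ` U\<rparr>))" for U
  define lagr' where "lagr' U \<longleftrightarrow> submodule U R G \<and>
        fin_gen R (G\<lparr>carrier := U\<rparr>) \<and> free_module R (G\<lparr>carrier := U\<rparr>) \<and>
        (\<forall>u\<in>U. dual_map (G\<lparr>carrier := U\<rparr>) (\<lambda>u. u) (dual_map G (\<sigma> \<circ> \<pi>) ((\<tau> \<circ> \<pi>) u))
                 = \<zero>\<^bsub>dual R bar (G\<lparr>carrier := U\<rparr>)\<^esub>) \<and>
        (\<forall>u\<in>U. (\<psi> \<circ> \<pi>) u = \<one>\<^bsub>Q_group R bar (\<ominus>\<^bsub>R\<^esub> \<epsilon>)\<^esub>) \<and>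
        inj_on (\<sigma> \<circ> \<pi>) U \<and> inj_on (\<tau> \<circ> \<pi>) U \<and>
        direct_summand R F ((\<sigma> \<circ> \<pi>) ` U) \<and> direct_summand R (dual R bar F) ((\<tau> \<circ> \<pi>) ` U) \<and>
        (\<lambda>C. the_elem ((\<lambda>f. restrict f ((\<sigma> \<circ> \<pi>) ` U)) ` C))
          \<in> mod_iso R (quot_mod (dual R bar F) ((\<tau> \<circ> \<pi>) ` U))
                      (dual R bar (F\<lparr>carrier := (\<sigma> \<circ> \<pi>) ` U\<rparr>))" for U
  \<comment> \<open>The summand and duality conditions depend on the images in \<open>F\<close> and
    its dual alone, and these coincide. Finite generation and freeness pass through the isomorphism
    from \<open>S\<close> to its image, and injectivity of \<open>\<sigma>\<close> or
    \<open>\<tau>\<close> on that image is injectivity of the composite on \<open>S\<close>.\<close>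
  have transfer: "lagr (\<pi> ` S) \<longleftrightarrow> lagr' S" if S: "submodule S R G" and inj: "inj_on \<pi> S" for S
  proof -
    have sub: "S \<subseteq> carrier G" by (rule subgroup.subset[OF submodule.axioms(1)[OF S], simplified])
    have S': "submodule (\<pi> ` S) R H" by (rule submodule_image[OF G(1) H p S])
    note iso = G.submodule_left_module[OF S] H.submodule_left_module[OF S']
      mod_iso_submodule_image[OF G(1) p S inj]
    show ?thesis
      unfolding lagr_def lagr'_def vanishing_pullback_iff[OF p sub] image_comp
        comp_inj_on_iff[OF inj, symmetric] mod_iso_fin_gen_iff[OF iso] mod_iso_free_iff[OF iso]
      using S S' by simp
  qed
  have "(\<exists>U. lagr U) \<longleftrightarrow> (\<exists>S. lagr' S)"
  proof
    assume "\<exists>U. lagr U"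
    then obtain U where U: "lagr U" ..
    have "submodule U R H" "free_module R (H\<lparr>carrier := U\<rparr>)" using U by (auto simp: lagr_def)
    moreover from this have "U \<subseteq> \<pi> ` carrier G"
      using subgroup.subset[OF submodule.axioms(1)] by (fastforce simp: onto)
    ultimately obtain S where "submodule S R G" "inj_on \<pi> S" "\<pi> ` S = U"
      using free_submodule_lift[OF G(1) H p] by blast
    then show "\<exists>S. lagr' S" using transfer U by blast
  next
    assume "\<exists>S. lagr' S"
    then obtain S where S: "lagr' S" ..
    \<comment> \<open>Injectivity of a composite with \<open>\<pi>\<close> on \<open>S\<close>
      forces injectivity of \<open>\<pi>\<close> there.\<close>
    then have "submodule S R G" "inj_on \<pi> S" by (auto simp: lagr'_def intro: inj_on_imageI2)
    then show "\<exists>U. lagr U" using transfer S by blast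
  qed
  then show ?thesis
    using x split_preformation_pullback[OF x G p]
    unfolding elementary_preformation_def lagr_def lagr'_def by blast
qed

theorem corollary1p4p6:
  fixes \<Lambda> :: "('r, 'a) ring_scheme"
    and bar :: "'r \<Rightarrow> 'r"
    and q :: nat and \<epsilon> :: 'r
    and F :: "('r, 'f) module" and H :: "('r, 'h) module" and G :: "('r, 'g) module"
    and \<sigma> :: "'h \<Rightarrow> 'f" and \<tau> :: "'h \<Rightarrow> 'f \<Rightarrow> 'r" and \<psi> :: "'h \<Rightarrow> 'r set"
    and \<pi> :: "'g \<Rightarrow> 'h"
  assumes "ring_with_involution \<Lambda> bar"
    and "weakly_finite \<Lambda>"
    and "\<epsilon> = (\<ominus>\<^bsub>\<Lambda>\<^esub> \<one>\<^bsub>\<Lambda>\<^esub>) [^]\<^bsub>\<Lambda>\<^esub> q"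
    and "split_preformation \<Lambda> bar \<epsilon> F H \<sigma> \<tau> \<psi>"
    and "left_module \<Lambda> G" and "fin_gen \<Lambda> G" and "free_module \<Lambda> G"
    and "\<pi> \<in> mod_hom \<Lambda> G H" and "\<pi> ` carrier G = carrier H"
  shows "\<exists>\<gamma> \<mu> \<theta>.
      split_preformation \<Lambda> bar \<epsilon> F G \<gamma> \<mu> \<theta> \<and>
      (\<forall>x\<in>carrier G. \<gamma> x = \<sigma> (\<pi> x) \<and> \<mu> x = \<tau> (\<pi> x) \<and> \<theta> x = \<psi> (\<pi> x)) \<and>
      regular_preformation \<Lambda> bar \<epsilon> F G \<gamma> \<mu> \<theta> \<and>
      (elementary_preformation \<Lambda> bar \<epsilon> F H \<sigma> \<tau> \<psi>
         \<longleftrightarrow> elementary_preformation \<Lambda> bar \<epsilon> F G \<gamma> \<mu> \<theta>)"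
proof -
  note pullback = split_preformation_pullback[OF assms(4-6,8)]
  \<comment> \<open>The composites with \<open>\<pi>\<close> are the witnesses, and regularity of
    the pullback is the freeness of \<open>G\<close>.\<close>
  show ?thesis
    using pullback assms(7) elementary_pullback_iff[OF assms(4-6,8,9)]
    by (intro exI[of _ "\<sigma> \<circ> \<pi>"] exI[of _ "\<tau> \<circ> \<pi>"] exI[of _ "\<psi> \<circ> \<pi>"])
      (simp add: regular_preformation_def)
qed

end
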